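(* Let $q\in\mathbb{N}$ be fixed, and suppose that $\langle N\rangle\to\infty$, $\langle M\rangle\to\infty$ and $\kappa:=\langle M\rangle^{q+1}/\langle N\rangle\to0$. Then the rescaled Young diagrams converge to the limit shape $y=\omega_q^*(x)$ in $\mathsf{P}_{\boldsymbol z}$-probability uniformly for $x\ge0$, that is, for every $\varepsilon>0$, $$\mathsf{P}_{\boldsymbol z}\left(\lambda\in\check\Lambda^q:\ \sup_{x\ge0}\bigl|\widetilde Y_\lambda(x)-\omega_q^*(x)\bigr|>\varepsilon\right)\to0.$$
   Context: $\mathbb{N}=\{1,2,\dots\}$, $\mathbb{N}^q=\{j^q: j\in\mathbb{N}\}$. $\check{\Lambda}^q$ is the set of all strict integer partitions into $q$-th powers, i.e. finite (possibly empty) sequences $\lambda_1>\lambda_2>\cdots$ of distinct elements of $\mathbb{N}^q$. For $\lambda\in\check\Lambda^q$ and $\ell\in\mathbb{N}^q$, $\nu_\ell\in\{0,1\}$ is the multiplicity of $\ell$ in $\lambda$; the weight is $N_\lambda=\sum_\ell\ell\nu_\ell$, the length is $M_\lambda=\sum_\ell\nu_\ell$. For $\boldsymbol z=(z_1,z_2)$ with $0<z_1<1$, $z_2>0$, the Boltzmann distribution on $\check\Lambda^q$ is $\mathsf{P}_{\boldsymbol z}(\lambda)=z_1^{N_\lambda}z_2^{M_\lambda}/F(\boldsymbol z)$, where $F(\boldsymbol z)=\sum_{\lambda\in\check\Lambda^q}z_1^{N_\lambda}z_2^{M_\lambda}$; $\mathsf{E}_{\boldsymbol z}$ is the corresponding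 expectation. Given real hyper-parameters $\langle N\rangle,\langle M\rangle>0$, $\boldsymbol z$ is calibrated as the root of $\mathsf{E}_{\boldsymbol z}(N_\lambda)=\langle N\rangle$, $\mathsf{E}_{\boldsymbol z}(M_\lambda)=\langle M\rangle$; it satisfies $z_1=\exp\bigl(-\frac{\langle M\rangle}{q\langle N\rangle}(1+O(\kappa^{1/q}))\bigr)$, $z_2=\frac{\kappa^{1/q}}{q^{1/q}\Gamma(1+1/q)}(1+O(\kappa^{1/q}))$. The upper boundary of the Young diagram of $\lambda$ is $Y_\lambda(x)=\sum_{\ell\ge x}\nu_\ell$ ($x\ge0$). With $A:=q\langle N\rangle/\langle M\rangle$ and $B:=\langle M\rangle$, the scaled boundary is $\widetilde Y_\lambda(x)=B^{-1}Y_\lambda(Ax)$. The limit shape is $\omega_q^*(x)=\frac{1}{\Gamma(1/q)}\int_x^\infty u^{1/q-1}e^{-u}\,du$, $x\ge0$. *)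

theory Defs
  imports "HOL-Probability.Probability"
begin

definition qth_powers :: "nat \<Rightarrow> nat set" where
  "qth_powers q = {j ^ q | j. j \<ge> 1}"

definition strict_partitions :: "nat \<Rightarrow> nat list set" where
  "strict_partitions q = {p. sorted_wrt (>) p \<and> set p \<subseteq> qth_powers q}"

abbreviation multiplicity_of :: "nat \<Rightarrow> nat list \<Rightarrow> nat" ("\<nu>") where
  "\<nu> l p \<equiv> count_list p l"

text \<open>The multiplicity of \<open>l\<close> in \<open>p\<close> vanishes unless \<open>l \<in> set p\<close>, so the sums over all parts
  below are taken over the finite set of parts that occur.\<close>

definition weight :: "nat list \<Rightarrow> nat" where
  "weight p = (\<Sum>l\<in>set p. l * \<nu> l p)"

definition len :: "nat list \<Rightarrow> nat" where
  "len p = (\<Sum>l\<in>set p. \<nu> l p)"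

definition gen_fun :: "nat \<Rightarrow> real \<Rightarrow> real \<Rightarrow> real" where
  "gen_fun q z1 z2 = (\<Sum>\<^sub>\<infinity>p\<in>strict_partitions q. z1 ^ weight p * z2 ^ len p)"

definition boltzmann :: "nat \<Rightarrow> real \<Rightarrow> real \<Rightarrow> nat list measure" where
  "boltzmann q z1 z2 =
     point_measure (strict_partitions q)
       (\<lambda>p. ennreal (z1 ^ weight p * z2 ^ len p / gen_fun q z1 z2))"

definition calibrated :: "nat \<Rightarrow> real \<Rightarrow> real \<Rightarrow> real \<Rightarrow> real \<Rightarrow> bool" where
  "calibrated q N M z1 z2 \<longleftrightarrow>
     0 < z1 \<and> z1 < 1 \<and> 0 < z2 \<and>
     (\<integral>p. real (weight p) \<partial>boltzmann q z1 z2) = N \<and>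
     (\<integral>p. real (len p) \<partial>boltzmann q z1 z2) = M"

definition young_boundary :: "nat list \<Rightarrow> real \<Rightarrow> real" where
  "young_boundary p x = real (\<Sum>l | l \<in> set p \<and> real l \<ge> x. \<nu> l p)"

definition scaled_boundary :: "nat \<Rightarrow> real \<Rightarrow> real \<Rightarrow> nat list \<Rightarrow> real \<Rightarrow> real" where
  "scaled_boundary q N M p x =
     (let A = real q * N / M; B = M in young_boundary p (A * x) / B)"

definition limit_shape :: "nat \<Rightarrow> real \<Rightarrow> real" where
  "limit_shape q x =
     1 / Gamma (1 / real q) * (LBINT u:{x..}. u powr (1 / real q - 1) * exp (- u))"

end

theory Submission
  imports Defs
begin

text \<open>Under the Boltzmann distribution the parts occur independently, a part \<open>l\<close> with probability
  \<open>z2 * z1 ^ l / (1 + z2 * z1 ^ l)\<close>. Hence the variance of a count of parts is at most its mean, and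
  Chebyshev's inequality reduces the claim to the convergence of the expected boundary. Put
  \<open>z1 = exp (- (h ^ q))\<close>. A fugacity \<open>z2\<close> bounded away from zero would force
  \<open>\<langle>N\<rangle> = O(\<langle>M\<rangle> ^ (q + 1))\<close>, so \<open>z2\<close> tends to zero, and then so does \<open>h\<close>; the expectations
  become Riemann sums of \<open>exp (- (y ^ q))\<close> and \<open>y ^ q * exp (- (y ^ q))\<close> with mesh \<open>h\<close>, which fixes
  \<open>h ^ q * \<langle>N\<rangle> / \<langle>M\<rangle>\<close> in the limit. Monotonicity gives uniformity.\<close>

section \<open>The Boltzmann distribution\<close>

text \<open>The behaviour of \<open>z1\<close> and \<open>z2\<close> has to be extracted from the
  two calibration equations. The obstacle is a large \<open>z2\<close>: the odds then exceed 1 and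
  say little about \<open>odds / (1 + odds)\<close>, which stays near 1 on a long plateau.
  Stretching the length scale by a factor depending on \<open>ln z2\<close> absorbs the plateau.
  With \<open>b\<close> the stretched mesh, \<open>M\<close> is at least a constant times
  \<open>1 / b\<close>, and \<open>N\<close> at most a constant times
  \<open>1 / b ^ (q + 1)\<close>; this is where the power in \<open>M ^ (q + 1) / N\<close> comes
  from. Once \<open>z2\<close> is bounded, so is \<open>h * M\<close>, and \<open>h\<close> tends to
  zero. The rates of \<open>h\<close> and \<open>z2\<close> are never computed separately:
  \<open>M\<close> and \<open>h ^ q * N\<close> both carry the factor \<open>z2 / h\<close>, which
  cancels in quotients. What remains is 1/q, the quotient of the integrals of
  \<open>y ^ q * exp (- (y ^ q))\<close> and \<open>exp (- (y ^ q))\<close> over the half-line. It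
  cancels the \<open>q\<close> in \<open>A = q * N / M\<close>, so that \<open>h ^ q * A\<close>
  tends to 1 and the limit shape appears at the right abscissa.\<close>

lemma strict_partition_distinct: "p \<in> strict_partitions q \<Longrightarrow> distinct p"
proof -
  assume "p \<in> strict_partitions q"
  then have "sorted_wrt (<) (rev p)"
    by (simp add: strict_partitions_def sorted_wrt_rev)
  then show ?thesis
    by (simp add: strict_sorted_iff)
qed

text \<open>On finite sets, adding or deleting a part is plain insertion or removal.
  \<open>sorted_list_of_set\<close> is ascending whereas partitions are listed in descending order,
  hence the \<open>rev\<close>.\<close>

lemma bij_betw_set_strict_partitions:
  "bij_betw set (strict_partitions q) {S. finite S \<and> S \<subseteq> qth_powers q}"
proof (rule bij_betw_byWitness[where f' = "\<lambda>S. rev (sorted_list_of_set S)"])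
  show "\<forall>p\<in>strict_partitions q. rev (sorted_list_of_set (set p)) = p"
  proof
    fix p assume "p \<in> strict_partitions q"
    then have "sorted_wrt (<) (rev p)"
      by (simp add: strict_partitions_def sorted_wrt_rev)
    then have "sorted_list_of_set (set (rev p)) = rev p"
      by (metis List.finite_set sorted_list_of_set_unique sorted_list_of_set.idem_if_sorted_distinct strict_sorted_iff)
    then show "rev (sorted_list_of_set (set p)) = p" by simp
  qed
qed (auto simp: strict_partitions_def sorted_wrt_rev)

lemma count_list_distinct: "distinct xs \<Longrightarrow> x \<in> set xs \<Longrightarrow> count_list xs x = 1"
  by (induction xs) (auto simp: count_list_0_iff)

lemma sum_count_list_strict:
  assumes "p \<in> strict_partitions q" "A \<subseteq> set p"
  shows "(\<Sum>l\<in>A. f l * \<nu> l p) = (\<Sum>l\<in>A. f l)"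
  using assms strict_partition_distinct[OF assms(1)]
  by (intro sum.cong) (auto simp: count_list_distinct subset_iff)

lemma weight_strict: "p \<in> strict_partitions q \<Longrightarrow> weight p = \<Sum>(set p)"
  unfolding weight_def by (subst sum_count_list_strict) auto

lemma len_strict: "p \<in> strict_partitions q \<Longrightarrow> len p = card (set p)"
  unfolding len_def using sum_count_list_strict[of p q "set p" "\<lambda>_. 1"] by simp

lemma young_boundary_strict:
  assumes "p \<in> strict_partitions q"
  shows "young_boundary p x = (\<Sum>l\<in>set p. if real l \<ge> x then 1 else 0)"
proof -
  have "(\<Sum>l | l \<in> set p \<and> real l \<ge> x. \<nu> l p) = card {l \<in> set p. real l \<ge> x}"
    using sum_count_list_strict[of p q "{l \<in> set p. real l \<ge> x}" "\<lambda>_. 1"] assms by auto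
  then show ?thesis
    by (simp add: young_boundary_def sum.If_cases Int_def)
qed

lemma qth_powers_eq_range: "qth_powers q = range (\<lambda>j. Suc j ^ q)"
  by (auto simp: qth_powers_def image_def) (metis Suc_pred' less_eq_Suc_le One_nat_def)

lemma inj_Suc_power: "q \<ge> 1 \<Longrightarrow> inj (\<lambda>j. Suc j ^ q)"
  by (auto intro!: injI dest: power_inject_base simp: power_eq_iff_eq_base)

section \<open>Product form of the weights and the normalising constant\<close>

locale boltzmann_params =
  fixes q :: nat and z1 z2 :: real
  assumes q: "q \<ge> 1" and z1: "0 < z1" "z1 < 1" and z2: "0 < z2"
begin

abbreviation "SP \<equiv> strict_partitions q"
abbreviation "P \<equiv> boltzmann q z1 z2"
abbreviation "Z \<equiv> gen_fun q z1 z2"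

text \<open>\<open>odds l\<close> is the factor that a part \<open>l\<close> contributes to the
  weight of a partition; \<open>occ l\<close> is the probability with these odds, and
  \<open>prob_part\<close> identifies it as the probability that \<open>l\<close> occurs.\<close>

definition odds :: "nat \<Rightarrow> real" where "odds l = z2 * z1 ^ l"
definition occ :: "nat \<Rightarrow> real" where "occ l = odds l / (1 + odds l)"

lemma odds_pos: "odds l > 0"
  using z1 z2 by (simp add: odds_def)

lemma occ_nonneg: "occ l \<ge> 0"
  using odds_pos[of l] by (simp add: occ_def)

lemma occ_le_odds: "occ l \<le> odds l"
  using odds_pos[of l] by (simp add: occ_def field_simps)

lemma summable_odds: "summable (\<lambda>j. odds (Suc j ^ q))"
proof (rule summable_comparison_test')
  show "summable (\<lambda>j. z2 * z1 ^ j)"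
    using z1 by (intro summable_mult summable_geometric) auto
  fix j :: nat
  have "j \<le> Suc j ^ q"
    using self_le_power[of "Suc j" q] q by linarith
  then show "norm (odds (Suc j ^ q)) \<le> z2 * z1 ^ j"
    using z1 z2 by (auto simp: odds_def intro!: power_decreasing)
qed

lemma summable_occ: "summable (\<lambda>j. occ (Suc j ^ q))"
  by (rule summable_comparison_test'[OF summable_odds]) (simp add: occ_nonneg occ_le_odds)

lemma partition_weight:
  "p \<in> SP \<Longrightarrow> z1 ^ weight p * z2 ^ len p = (\<Prod>l\<in>set p. odds l)"
  by (simp add: weight_strict len_strict odds_def prod.distrib power_sum)

text \<open>The sum over all subsets is the expanded product of the factors
  \<open>1 + odds l\<close>, and \<open>1 + x \<le> exp x\<close> turns it into a bound independent
  of \<open>U\<close>. It therefore bounds every finite partial sum of the generating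
  function.\<close>

lemma sum_prod_odds_le:
  assumes "finite U" "U \<subseteq> qth_powers q"
  shows "(\<Sum>S\<in>Pow U. \<Prod>l\<in>S. odds l) \<le> exp (\<Sum>j. odds (Suc j ^ q))"
proof -
  have "(\<Sum>S\<in>Pow U. \<Prod>l\<in>S. odds l) = (\<Prod>l\<in>U. odds l + 1)"
    using assms by (simp add: prod_add)
  also have "\<dots> \<le> (\<Prod>l\<in>U. exp (odds l))"
    using odds_pos by (intro prod_mono) (auto simp: add.commute less_imp_le add_nonneg_nonneg exp_ge_add_one_self)
  also have "\<dots> = exp (\<Sum>l\<in>U. odds l)"
    using assms by (simp add: exp_sum)
  also have "\<dots> \<le> exp (\<Sum>j. odds (Suc j ^ q))"
  proof -
    obtain J where J: "U = (\<lambda>j. Suc j ^ q) ` J" "finite J"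
      using assms finite_subset_image[of U "\<lambda>j. Suc j ^ q" UNIV]
      by (auto simp: qth_powers_eq_range)
    have "(\<Sum>l\<in>U. odds l) = (\<Sum>j\<in>J. odds (Suc j ^ q))"
      unfolding J using inj_Suc_power[OF q] by (subst sum.reindex) (auto intro: inj_on_subset)
    also have "\<dots> \<le> (\<Sum>j. odds (Suc j ^ q))"
      using J summable_odds odds_pos by (intro sum_le_suminf) (auto simp: less_imp_le)
    finally show ?thesis by simp
  qed
  finally show ?thesis .
qed

lemma summable_partition_weight: "(\<lambda>p. z1 ^ weight p * z2 ^ len p) summable_on SP"
proof (rule nonneg_bdd_above_summable_on)
  show "0 \<le> z1 ^ weight p * z2 ^ len p" for p
    using z1 z2 by simp
  show "bdd_above (sum (\<lambda>p. z1 ^ weight p * z2 ^ len p) ` {F. F \<subseteq> SP \<and> finite F})"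
  proof (rule bdd_aboveI2)
    fix F assume "F \<in> {F. F \<subseteq> SP \<and> finite F}"
    then have F: "F \<subseteq> SP" "finite F" by auto
    have inj: "inj_on set F"
      using bij_betw_set_strict_partitions[of q] F by (auto simp: bij_betw_def intro: inj_on_subset)
    let ?U = "\<Union>p\<in>F. set p"
    have U: "?U \<subseteq> qth_powers q"
      using F by (auto simp: strict_partitions_def)
    have "(\<Sum>p\<in>F. z1 ^ weight p * z2 ^ len p) = (\<Sum>p\<in>F. \<Prod>l\<in>set p. odds l)"
      using F by (intro sum.cong) (auto simp: partition_weight)
    also have "\<dots> = (\<Sum>S\<in>set ` F. \<Prod>l\<in>S. odds l)"
      using inj by (simp add: sum.reindex)
    also have "\<dots> \<le> (\<Sum>S\<in>Pow ?U. \<Prod>l\<in>S. odds l)"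
      using F odds_pos by (intro sum_mono2) (auto intro!: prod_nonneg simp: less_imp_le)
    also have "\<dots> \<le> exp (\<Sum>j. odds (Suc j ^ q))"
      using F U by (intro sum_prod_odds_le) auto
    finally show "(\<Sum>p\<in>F. z1 ^ weight p * z2 ^ len p) \<le> exp (\<Sum>j. odds (Suc j ^ q))" .
  qed
qed

text \<open>The empty partition alone contributes 1.\<close>

lemma gen_fun_pos: "Z > 0"
proof -
  have "(\<Sum>p\<in>{[]}. z1 ^ weight p * z2 ^ len p) \<le> Z"
    unfolding gen_fun_def
    using z1 z2 summable_partition_weight
    by (intro finite_sum_le_infsum) (auto simp: strict_partitions_def)
  then show ?thesis by (simp add: weight_def len_def)
qed

lemma space_P [simp]: "space P = SP" and sets_P [simp]: "sets P = Pow SP"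
  by (simp_all add: boltzmann_def space_point_measure sets_point_measure)

lemma measurable_P [measurable, simp]: "f \<in> borel_measurable P" for f :: "_ \<Rightarrow> 'b::topological_space"
  by (simp add: boltzmann_def)

lemma nn_integral_boltzmann:
  "(\<integral>\<^sup>+p. f p \<partial>P) = (\<integral>\<^sup>+p. ennreal (z1 ^ weight p * z2 ^ len p / Z) * f p \<partial>count_space SP)"
  by (simp add: boltzmann_def point_measure_def nn_integral_density)

lemma nn_integral_P:
  "(\<integral>\<^sup>+p. f p \<partial>P) = (\<integral>\<^sup>+p. ennreal ((\<Prod>l\<in>set p. odds l) / Z) * f p \<partial>count_space SP)"
proof -
  have "(\<integral>\<^sup>+p. f p \<partial>P) = (\<integral>\<^sup>+p. ennreal (z1 ^ weight p * z2 ^ len p / Z) * f p \<partial>count_space SP)"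
    by (rule nn_integral_boltzmann)
  also have "\<dots> = (\<integral>\<^sup>+p. ennreal ((\<Prod>l\<in>set p. odds l) / Z) * f p \<partial>count_space SP)"
    by (intro nn_integral_cong) (simp add: partition_weight)
  finally show ?thesis .
qed

lemma nn_integral_P_set:
  fixes f :: "nat set \<Rightarrow> ennreal"
  shows "(\<integral>\<^sup>+p. f (set p) \<partial>P) =
   (\<integral>\<^sup>+S. ennreal ((\<Prod>l\<in>S. odds l) / Z) * f S \<partial>count_space {S. finite S \<and> S \<subseteq> qth_powers q})"
  unfolding nn_integral_P
  by (rule nn_integral_bij_count_space[OF bij_betw_set_strict_partitions,
        where f = "\<lambda>S. ennreal ((\<Prod>l\<in>S. odds l) / Z) * f S"])

lemma prob_space_P: "prob_space P"
proof
  let ?f = "\<lambda>p. z1 ^ weight p * z2 ^ len p"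
  have nn: "?f p \<ge> 0" for p using z1 z2 by simp
  have "Infinite_Set_Sum.abs_summable_on ?f SP"
    using summable_partition_weight nn by (subst abs_summable_equivalent[symmetric]) simp
  then have *: "(\<integral>\<^sup>+p. ?f p \<partial>count_space SP) = ennreal Z"
    using nn by (simp add: nn_integral_conv_infsetsum infsetsum_infsum gen_fun_def)
  have "emeasure P (space P) = (\<integral>\<^sup>+p. ennreal (?f p / Z) \<partial>count_space SP)"
    using nn_integral_boltzmann[of "\<lambda>_. 1"] by simp
  also have "\<dots> = (\<integral>\<^sup>+p. ennreal (1 / Z) * ennreal (?f p) \<partial>count_space SP)"
    using nn gen_fun_pos by (intro nn_integral_cong) (simp flip: ennreal_mult)
  also have "\<dots> = 1"
    using * gen_fun_pos by (simp add: nn_integral_cmult flip: ennreal_mult)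
  finally show "emeasure P (space P) = 1" .
qed

sublocale prob_space P by (rule prob_space_P)

section \<open>Independence of the parts\<close>

lemma nn_integral_indicator_P:
  "(\<integral>\<^sup>+p. indicator {p. R p} p \<partial>P) = emeasure P {p \<in> SP. R p}"
proof -
  have "(\<integral>\<^sup>+p. indicator {p. R p} p \<partial>P) = (\<integral>\<^sup>+p. indicator {p \<in> SP. R p} p \<partial>P)"
    by (intro nn_integral_cong) (auto simp: indicator_def)
  also have "\<dots> = emeasure P {p \<in> SP. R p}"
    by (rule nn_integral_indicator) auto
  finally show ?thesis .
qed

text \<open>Adding the part \<open>j\<close> is a bijection that multiplies the weight by the odds of \<open>j\<close>.\<close>

lemma emeasure_with_part:
  assumes j: "j \<in> qth_powers q" and B: "\<And>S. B (insert j S) \<longleftrightarrow> B S"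
  shows "emeasure P {p \<in> SP. B (set p) \<and> j \<in> set p} =
         ennreal (odds j) * emeasure P {p \<in> SP. B (set p) \<and> j \<notin> set p}"
proof -
  let ?FS = "{S. finite S \<and> S \<subseteq> qth_powers q}"
  let ?W = "\<lambda>S. ennreal ((\<Prod>l\<in>S. odds l) / Z)"
  have em: "emeasure P {p \<in> SP. R (set p)} = (\<integral>\<^sup>+S. ?W S \<partial>count_space {S\<in>?FS. R S})" for R
  proof -
    have "emeasure P {p \<in> SP. R (set p)} = (\<integral>\<^sup>+p. indicator {S. R S} (set p) \<partial>P)"
      by (subst nn_integral_indicator_P[symmetric]) (auto intro!: nn_integral_cong simp: indicator_def)
    also have "\<dots> = (\<integral>\<^sup>+S. ?W S * indicator {S. R S} S \<partial>count_space ?FS)"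
      by (rule nn_integral_P_set)
    also have "\<dots> = (\<integral>\<^sup>+S. ?W S \<partial>count_space {S\<in>?FS. R S})"
      by (auto simp: nn_integral_count_space_indicator indicator_def intro!: nn_integral_cong)
    finally show ?thesis .
  qed
  \<comment> \<open>The property \<open>B\<close> also survives deletion of \<open>j\<close>: the
    hypothesis is applied to \<open>S - {j}\<close>.\<close>
  have bij: "bij_betw (insert j) {S\<in>?FS. B S \<and> j \<notin> S} {S\<in>?FS. B S \<and> j \<in> S}"
    by (rule bij_betw_byWitness[where f' = "\<lambda>S. S - {j}"])
       (use j B in \<open>auto simp: insert_absorb B simp flip: B[of "_ - {j}"]\<close>)
  have "emeasure P {p \<in> SP. B (set p) \<and> j \<in> set p} = (\<integral>\<^sup>+S. ?W S \<partial>count_space {S\<in>?FS. B S \<and> j \<in> S})"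
    by (rule em)
  also have "\<dots> = (\<integral>\<^sup>+S. ?W (insert j S) \<partial>count_space {S\<in>?FS. B S \<and> j \<notin> S})"
    using bij by (rule nn_integral_bij_count_space[symmetric])
  also have "\<dots> = (\<integral>\<^sup>+S. ennreal (odds j) * ?W S \<partial>count_space {S\<in>?FS. B S \<and> j \<notin> S})"
    using odds_pos gen_fun_pos
    by (intro nn_integral_cong) (auto simp: less_imp_le prod_nonneg simp flip: ennreal_mult)
  also have "\<dots> = ennreal (odds j) * (\<integral>\<^sup>+S. ?W S \<partial>count_space {S\<in>?FS. B S \<and> j \<notin> S})"
    by (rule nn_integral_cmult) simp
  also have "\<dots> = ennreal (odds j) * emeasure P {p \<in> SP. B (set p) \<and> j \<notin> set p}"
    by (subst em[symmetric]) simp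
  finally show ?thesis .
qed

text \<open>The probabilities with and without \<open>j\<close> have ratio \<open>odds j\<close> and
  add up to the probability of \<open>B\<close>; solving for the former gives the factor
  \<open>occ j\<close>. So an event blind to \<open>j\<close> is independent of the presence of
  \<open>j\<close>; taking "\<open>i\<close> is present" as the event gives the pairwise
  independence behind the variance bound.\<close>

lemma prob_with_part:
  assumes j: "j \<in> qth_powers q" and B: "\<And>S. B (insert j S) \<longleftrightarrow> B S"
  shows "prob {p \<in> SP. B (set p) \<and> j \<in> set p} = occ j * prob {p \<in> SP. B (set p)}"
proof -
  have "ennreal (prob {p \<in> SP. B (set p) \<and> j \<in> set p}) =
      ennreal (odds j * prob {p \<in> SP. B (set p) \<and> j \<notin> set p})"
    using emeasure_with_part[where B = B, OF assms] odds_pos[of j]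
    by (simp add: emeasure_eq_measure ennreal_mult less_imp_le)
  then have 1: "prob {p \<in> SP. B (set p) \<and> j \<in> set p} = odds j * prob {p \<in> SP. B (set p) \<and> j \<notin> set p}"
    using odds_pos[of j] by (simp add: less_imp_le)
  have "prob {p \<in> SP. B (set p)} = prob ({p \<in> SP. B (set p) \<and> j \<in> set p} \<union> {p \<in> SP. B (set p) \<and> j \<notin> set p})"
    by (rule arg_cong[where f = prob]) auto
  also have "\<dots> = prob {p \<in> SP. B (set p) \<and> j \<in> set p} + prob {p \<in> SP. B (set p) \<and> j \<notin> set p}"
    by (rule finite_measure_Union) auto
  finally show ?thesis
    using 1 odds_pos[of j] by (simp add: occ_def field_simps)
qed

lemma prob_part: "j \<in> qth_powers q \<Longrightarrow> prob {p \<in> SP. j \<in> set p} = occ j"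
  using prob_with_part[of j "\<lambda>_. True"] prob_space by simp

lemma prob_two_parts:
  assumes "i \<in> qth_powers q" "j \<in> qth_powers q" "i \<noteq> j"
  shows "prob {p \<in> SP. i \<in> set p \<and> j \<in> set p} = occ i * occ j"
  using prob_with_part[of j "\<lambda>S. i \<in> S"] prob_part[of i] assms by auto

section \<open>Moments of additive statistics and Chebyshev's bound\<close>

abbreviation qpow :: "nat \<Rightarrow> nat" where "qpow j \<equiv> Suc j ^ q"

text \<open>The sum over a random set becomes a series over a fixed index set with indicators. In
  \<open>ennreal\<close> such a series may be integrated term by term without summability
  conditions.\<close>

lemma sum_set_eq_suminf:
  assumes "p \<in> SP" "\<And>l. c l \<ge> 0"
  shows "ennreal (\<Sum>l\<in>set p. c l) = (\<Sum>j. ennreal (c (qpow j)) * indicator {p. qpow j \<in> set p} p)"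
proof -
  let ?J = "(\<lambda>j. qpow j) -` set p"
  have fin: "finite ?J"
    using inj_Suc_power[OF q] by (intro finite_vimageI) auto
  have "set p = (\<lambda>j. qpow j) ` ?J"
    using assms by (auto simp: strict_partitions_def qth_powers_eq_range)
  then have "(\<Sum>l\<in>set p. c l) = (\<Sum>l\<in>(\<lambda>j. qpow j) ` ?J. c l)"
    by simp
  also have "\<dots> = (\<Sum>j\<in>?J. c (qpow j))"
    using inj_Suc_power[OF q] by (subst sum.reindex) (auto intro: inj_on_subset)
  finally have "ennreal (\<Sum>l\<in>set p. c l) = (\<Sum>j\<in>?J. ennreal (c (qpow j)))"
    using assms by (simp add: sum_ennreal)
  also have "\<dots> = (\<Sum>j\<in>?J. ennreal (c (qpow j)) * indicator {p. qpow j \<in> set p} p)"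
    by (intro sum.cong) auto
  also have "\<dots> = (\<Sum>j. ennreal (c (qpow j)) * indicator {p. qpow j \<in> set p} p)"
    using fin by (intro suminf_finite[symmetric]) auto
  finally show ?thesis .
qed

lemma nn_integral_additive:
  assumes "\<And>l. c l \<ge> 0"
  shows "(\<integral>\<^sup>+p. ennreal (\<Sum>l\<in>set p. c l) \<partial>P) = (\<Sum>j. ennreal (c (qpow j) * occ (qpow j)))"
proof -
  have "(\<integral>\<^sup>+p. ennreal (\<Sum>l\<in>set p. c l) \<partial>P) =
      (\<integral>\<^sup>+p. (\<Sum>j. ennreal (c (qpow j)) * indicator {p. qpow j \<in> set p} p) \<partial>P)"
    using assms by (intro nn_integral_cong sum_set_eq_suminf) auto
  also have "\<dots> = (\<Sum>j. \<integral>\<^sup>+p. ennreal (c (qpow j)) * indicator {p. qpow j \<in> set p} p \<partial>P)"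
    by (rule nn_integral_suminf) simp
  also have "\<dots> = (\<Sum>j. ennreal (c (qpow j) * occ (qpow j)))"
    using assms occ_nonneg
    by (intro suminf_cong)
       (simp add: nn_integral_cmult nn_integral_indicator_P emeasure_eq_measure prob_part qth_powers_eq_range ennreal_mult)
  finally show ?thesis .
qed

lemma expectation_additive:
  assumes c: "\<And>l. c l \<ge> 0" and s: "summable (\<lambda>j. c (qpow j) * occ (qpow j))"
  shows "expectation (\<lambda>p. \<Sum>l\<in>set p. c l) = (\<Sum>j. c (qpow j) * occ (qpow j))"
proof -
  have "expectation (\<lambda>p. \<Sum>l\<in>set p. c l) = enn2real (\<integral>\<^sup>+p. ennreal (\<Sum>l\<in>set p. c l) \<partial>P)"
    using c by (intro integral_eq_nn_integral) (auto intro: sum_nonneg)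
  also have "\<dots> = enn2real (ennreal (\<Sum>j. c (qpow j) * occ (qpow j)))"
    using c occ_nonneg s by (simp add: nn_integral_additive suminf_ennreal2)
  finally show ?thesis
    using c occ_nonneg s by (simp add: suminf_nonneg)
qed

text \<open>The square is expanded into a double series. Distinct parts factor by independence and
  give at most the squared mean; the diagonal gives at most the mean, because an indicator equals
  its square. Hence the variance is at most the mean.\<close>

lemma nn_integral_count_square:
  fixes c :: "nat \<Rightarrow> real" and D :: "nat set"
  defines "c \<equiv> indicator D"
  defines "t \<equiv> \<lambda>j. c (qpow j) * occ (qpow j)"
  shows "(\<integral>\<^sup>+p. ennreal ((\<Sum>l\<in>set p. c l)\<^sup>2) \<partial>P) \<le> ennreal ((suminf t)\<^sup>2 + suminf t)"
proof -
  let ?a = "\<lambda>j p. ennreal (c (qpow j)) * indicator {p. qpow j \<in> set p} p"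
  have c: "c l \<ge> 0" "c l \<le> 1" "c l * c l = c l" for l
    by (auto simp: c_def indicator_def)
  have t0: "t j \<ge> 0" for j using c occ_nonneg by (simp add: t_def)
  have "summable t"
  proof (rule summable_comparison_test'[OF summable_occ])
    show "norm (t j) \<le> occ (qpow j)" for j
      using mult_right_mono[OF c(2) occ_nonneg] t0 unfolding t_def by simp
  qed
  note t = t0 this
  \<comment> \<open>For \<open>i = j\<close> the exact value is \<open>t i\<close>. The surplus
    \<open>t j * t i\<close> is kept so that the first part of the double sum factors
    completely.\<close>
  have aa: "(\<integral>\<^sup>+p. ?a j p * ?a i p \<partial>P) \<le> ennreal (t j * t i + (if i = j then t i else 0))" for i j
  proof -
    have "(\<integral>\<^sup>+p. ?a j p * ?a i p \<partial>P) =
        (\<integral>\<^sup>+p. ennreal (c (qpow j) * c (qpow i)) * indicator {p. qpow j \<in> set p \<and> qpow i \<in> set p} p \<partial>P)"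
      using c by (intro nn_integral_cong) (auto simp: indicator_def ennreal_mult)
    also have "\<dots> = ennreal (c (qpow j) * c (qpow i) * prob {p \<in> SP. qpow j \<in> set p \<and> qpow i \<in> set p})"
      using c by (simp add: nn_integral_cmult nn_integral_indicator_P emeasure_eq_measure flip: ennreal_mult)
    also have "\<dots> \<le> ennreal (t j * t i + (if i = j then t i else 0))"
    proof (cases "i = j")
      case True
      then have "c (qpow j) * c (qpow i) * prob {p \<in> SP. qpow j \<in> set p \<and> qpow i \<in> set p} = t i"
        using c prob_part[of "qpow i"] by (simp add: t_def qth_powers_eq_range)
      then show ?thesis using True t by (auto intro!: ennreal_leI)
    next
      case False
      then have "qpow j \<noteq> qpow i"
        using inj_Suc_power[OF q] by (auto dest: injD)
      then show ?thesis
        using False prob_two_parts[of "qpow j" "qpow i"]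
        by (simp add: qth_powers_eq_range t_def mult_ac)
    qed
    finally show ?thesis .
  qed
  have "(\<integral>\<^sup>+p. ennreal ((\<Sum>l\<in>set p. c l)\<^sup>2) \<partial>P) = (\<integral>\<^sup>+p. (\<Sum>j. \<Sum>i. ?a j p * ?a i p) \<partial>P)"
  proof (rule nn_integral_cong)
    fix p assume "p \<in> space P"
    then have "ennreal (\<Sum>l\<in>set p. c l) = (\<Sum>j. ?a j p)"
      using c by (intro sum_set_eq_suminf) auto
    then have "ennreal ((\<Sum>l\<in>set p. c l)\<^sup>2) = (\<Sum>j. ?a j p) * (\<Sum>i. ?a i p)"
      using c by (simp add: power2_eq_square ennreal_mult sum_nonneg)
    also have "\<dots> = (\<Sum>j. \<Sum>i. ?a j p * ?a i p)"
      by (simp only: ennreal_suminf_multc ennreal_suminf_cmult)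
    finally show "ennreal ((\<Sum>l\<in>set p. c l)\<^sup>2) = (\<Sum>j. \<Sum>i. ?a j p * ?a i p)" .
  qed
  also have "\<dots> = (\<Sum>j. \<integral>\<^sup>+p. (\<Sum>i. ?a j p * ?a i p) \<partial>P)"
    by (rule nn_integral_suminf) simp
  also have "\<dots> = (\<Sum>j. \<Sum>i. \<integral>\<^sup>+p. ?a j p * ?a i p \<partial>P)"
    by (intro suminf_cong nn_integral_suminf) simp
  also have "\<dots> \<le> (\<Sum>j. \<Sum>i. ennreal (t j * t i + (if i = j then t i else 0)))"
    by (intro suminf_le aa) auto
  also have "\<dots> = (\<Sum>j. ennreal (t j * suminf t + t j))"
  proof (rule suminf_cong)
    fix j
    have "(\<lambda>i. if i = j then t i else 0) sums t j" by (rule sums_single)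
    then have "(\<lambda>i. t j * t i + (if i = j then t i else 0)) sums (t j * suminf t + t j)"
      using t by (intro sums_add sums_mult summable_sums)
    then show "(\<Sum>i. ennreal (t j * t i + (if i = j then t i else 0))) = ennreal (t j * suminf t + t j)"
      using t by (subst suminf_ennreal2) (auto simp: sums_iff)
  qed
  also have "\<dots> = ennreal ((suminf t)\<^sup>2 + suminf t)"
  proof -
    have "(\<lambda>j. t j * suminf t + t j) sums (suminf t * suminf t + suminf t)"
      using t by (intro sums_add sums_mult2 summable_sums)
    then show ?thesis
      using t by (subst suminf_ennreal2) (auto simp: sums_iff power2_eq_square suminf_nonneg)
  qed
  finally show ?thesis .
qed

text \<open>With the mean in the numerator, a deviation \<open>a\<close> proportional to the
  expected length has probability of the order of the inverse expected length.\<close>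

lemma count_deviation:
  fixes c :: "nat \<Rightarrow> real" and D :: "nat set"
  defines "c \<equiv> indicator D"
  defines "t \<equiv> \<Sum>j. c (qpow j) * occ (qpow j)"
  assumes a: "a > 0"
  shows "prob {p \<in> SP. \<bar>(\<Sum>l\<in>set p. c l) - t\<bar> \<ge> a} \<le> t / a\<^sup>2"
proof -
  let ?T = "\<lambda>p. \<Sum>l\<in>set p. c l"
  have c: "c l \<ge> 0" "c l \<le> 1" for l by (auto simp: c_def indicator_def)
  have s: "summable (\<lambda>j. c (qpow j) * occ (qpow j))"
    using c mult_right_mono[OF c(2) occ_nonneg] occ_nonneg
    by (intro summable_comparison_test'[OF summable_occ]) auto
  have t: "t \<ge> 0" unfolding t_def using s c occ_nonneg by (intro suminf_nonneg) auto
  have E: "expectation ?T = t"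
    unfolding t_def by (rule expectation_additive[OF c(1) s])
  have sq: "(\<integral>\<^sup>+p. ennreal ((?T p)\<^sup>2) \<partial>P) \<le> ennreal (t\<^sup>2 + t)"
    unfolding t_def c_def by (rule nn_integral_count_square)
  have int2: "integrable P (\<lambda>p. (?T p)\<^sup>2)"
    using sq by (intro integrableI_bounded) (auto intro: le_less_trans)
  have "expectation (\<lambda>p. (?T p)\<^sup>2) \<le> t\<^sup>2 + t"
    using sq t nn_integral_eq_integral[OF int2] by (simp del: ennreal_plus)
  moreover have "integrable P ?T"
    using int2 by (rule square_integrable_imp_integrable[rotated]) simp
  ultimately have "variance ?T \<le> t"
    using int2 by (subst variance_eq) (auto simp: E)
  moreover have "prob {p \<in> space P. \<bar>?T p - expectation ?T\<bar> \<ge> a} \<le> variance ?T / a\<^sup>2"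
    using int2 a by (intro Chebyshev_inequality) auto
  ultimately show ?thesis
    using a divide_right_mono[of "variance ?T" t "a\<^sup>2"] by (simp add: E)
qed

end

section \<open>The limit shape and Riemann sums\<close>

definition gamma_density :: "nat \<Rightarrow> real \<Rightarrow> real" where
  "gamma_density q u = u powr (1 / real q - 1) * exp (- u)"

lemma gamma_density_nonneg: "gamma_density q u \<ge> 0"
  by (simp add: gamma_density_def)

lemma gamma_density_borel [measurable]: "gamma_density q \<in> borel_measurable borel"
  unfolding gamma_density_def by measurable

context
  fixes q :: nat
  assumes q: "q \<ge> 1"
begin

lemma Gamma_inverse_pos: "Gamma (1 / real q) > 0"
  using q by (intro Gamma_real_pos) auto

lemma gamma_density_has_integral: "(gamma_density q has_integral Gamma (1 / real q)) {0..}"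
  using Gamma_integral_real[of "1 / real q"] q
  by (simp add: gamma_density_def[abs_def] exp_minus field_simps)

lemma gamma_density_set_integrable: "set_integrable lborel {0..} (gamma_density q)"
proof -
  have "gamma_density q absolutely_integrable_on {0..}"
    using gamma_density_has_integral gamma_density_nonneg
    by (intro nonnegative_absolutely_integrable_1) (auto simp: integrable_on_def)
  then show ?thesis
    by (simp add: set_integrable_def integrable_completion)
qed

lemma gamma_density_set_integrable_subset:
  "S \<in> sets borel \<Longrightarrow> S \<subseteq> {0..} \<Longrightarrow> set_integrable lborel S (gamma_density q)"
  by (rule set_integrable_subset[OF gamma_density_set_integrable]) auto

lemma gamma_density_integrable: "gamma_density q integrable_on {a..b}" if "0 \<le> a"
  using that gamma_density_set_integrable_subset[of "{a..b}"]
  by (auto intro: set_borel_integral_eq_integral)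

text \<open>Passing to the complement replaces the integral over a half-line by one over a compact
  interval, for which continuity, monotonicity and the derivative are available.\<close>

lemma limit_shape_eq:
  assumes "x \<ge> 0"
  shows "limit_shape q x = 1 - integral {0..x} (gamma_density q) / Gamma (1 / real q)"
proof -
  have "integral {0..} (gamma_density q) = integral ({0..x} \<union> {x..}) (gamma_density q)"
    using assms by (intro arg_cong[where f = "\<lambda>S. integral S _"]) auto
  also have "\<dots> = integral {0..x} (gamma_density q) + integral {x..} (gamma_density q)"
  proof (rule integral_Un)
    show "gamma_density q integrable_on {x..}"
      using assms gamma_density_set_integrable_subset[of "{x..}"]
      by (auto intro: set_borel_integral_eq_integral)
    have "{0..x} \<inter> {x..} = {x}" using assms by auto
    then show "negligible ({0..x} \<inter> {x..})" by simp
  qed (simp add: gamma_density_integrable)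
  finally have "integral {x..} (gamma_density q) = Gamma (1 / real q) - integral {0..x} (gamma_density q)"
    using gamma_density_has_integral by (simp add: integral_unique)
  moreover have "(LBINT u:{x..}. gamma_density q u) = integral {x..} (gamma_density q)"
    using assms by (intro set_borel_integral_eq_integral gamma_density_set_integrable_subset) auto
  ultimately show ?thesis
    using Gamma_inverse_pos by (simp add: limit_shape_def gamma_density_def[abs_def] field_simps)
qed

lemma limit_shape_0: "limit_shape q 0 = 1"
  by (simp add: limit_shape_eq)

text \<open>For \<open>q > 1\<close> the density is unbounded at 0, but continuity of an indefinite
  integral asks only for integrability, so the endpoint 0 is covered.\<close>

lemma limit_shape_continuous: "continuous_on {0..} (limit_shape q)"
proof -
  have "continuous_on {0..b} (\<lambda>x. 1 - integral {0..x} (gamma_density q) / Gamma (1 / real q))" for b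
    using Gamma_inverse_pos
    by (intro continuous_intros indefinite_integral_continuous_1 gamma_density_integrable) auto
  then have cont: "continuous_on {0..b} (limit_shape q)" for b
    by (rule continuous_on_eq) (simp add: limit_shape_eq)
  show ?thesis
    unfolding continuous_on_eq_continuous_within
  proof
    fix x :: real assume x: "x \<in> {0..}"
    have "at x within {0..} = at x within {0..x+1}"
      by (rule at_within_nhd[of _ "{..<x+1}"]) (use x in auto)
    then show "continuous (at x within {0..}) (limit_shape q)"
      using cont[of "x+1"] x by (simp add: continuous_on_eq_continuous_within)
  qed
qed

text \<open>The fundamental theorem is applied on \<open>{x / 2..2 * x}\<close>, which has
  \<open>x\<close> in its interior and keeps away from the singularity of the density at 0.\<close>

lemma limit_shape_has_derivative:
  assumes x: "x > 0"
  shows "(limit_shape q has_real_derivative - gamma_density q x / Gamma (1 / real q)) (at x)"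
proof -
  let ?I = "{x / 2..2 * x}"
  have "continuous_on ?I (gamma_density q)"
    unfolding gamma_density_def[abs_def] using x by (intro continuous_intros) auto
  then have "((\<lambda>u. integral {x / 2..u} (gamma_density q)) has_real_derivative gamma_density q x) (at x within ?I)"
    using x by (intro integral_has_real_derivative) auto
  then have "((\<lambda>u. 1 - (integral {0..x / 2} (gamma_density q) + integral {x / 2..u} (gamma_density q)) / Gamma (1 / real q))
      has_real_derivative - gamma_density q x / Gamma (1 / real q)) (at x within ?I)"
    using Gamma_inverse_pos by (auto intro!: derivative_eq_intros)
  moreover have "1 - (integral {0..x / 2} (gamma_density q) + integral {x / 2..u} (gamma_density q)) / Gamma (1 / real q)
      = limit_shape q u" if "u \<in> ?I" for u
    using that x
    by (subst Henstock_Kurzweil_Integration.integral_combine) (auto simp: limit_shape_eq intro: gamma_density_integrable)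
  ultimately have "(limit_shape q has_real_derivative - gamma_density q x / Gamma (1 / real q)) (at x within ?I)"
    using x by (subst (asm) has_field_derivative_cong_eventually)
       (auto simp: eventually_at_filter intro!: always_eventually)
  moreover have "x \<in> interior ?I" using x by simp
  ultimately show ?thesis by (simp only: at_within_interior)
qed

lemma limit_shape_antimono:
  assumes "0 \<le> x" "x \<le> y"
  shows "limit_shape q y \<le> limit_shape q x"
proof -
  have "integral {0..x} (gamma_density q) \<le> integral {0..y} (gamma_density q)"
    using assms by (intro integral_subset_le gamma_density_integrable) (auto simp: gamma_density_nonneg)
  then show ?thesis
    using assms Gamma_inverse_pos by (simp add: limit_shape_eq divide_right_mono less_imp_le)
qed

lemma limit_shape_tendsto_0: "(limit_shape q \<longlongrightarrow> 0) at_top"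
proof -
  have "((\<lambda>y. \<integral>x. indicator {..y} x *\<^sub>R (indicator {0..} x *\<^sub>R gamma_density q x) \<partial>lborel) \<longlongrightarrow>
      (\<integral>x. indicator {0..} x *\<^sub>R gamma_density q x \<partial>lborel)) at_top"
    using gamma_density_set_integrable by (intro tendsto_integral_at_top) (auto simp: set_integrable_def)
  moreover have "(\<integral>x. indicator {0..} x *\<^sub>R gamma_density q x \<partial>lborel) = Gamma (1 / real q)"
    using set_borel_integral_eq_integral(2)[OF gamma_density_set_integrable] gamma_density_has_integral
    by (simp add: set_lebesgue_integral_def integral_unique)
  moreover have "(\<integral>x. indicator {..y} x *\<^sub>R (indicator {0..} x *\<^sub>R gamma_density q x) \<partial>lborel) =
      integral {0..y} (gamma_density q)" for y
  proof -
    have "(\<integral>x. indicator {..y} x *\<^sub>R (indicator {0..} x *\<^sub>R gamma_density q x) \<partial>lborel) = (LBINT x:{0..y}. gamma_density q x)"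
      unfolding set_lebesgue_integral_def by (intro Bochner_Integration.integral_cong) (auto simp: indicator_def)
    also have "\<dots> = integral {0..y} (gamma_density q)"
      by (intro set_borel_integral_eq_integral gamma_density_set_integrable_subset) auto
    finally show ?thesis .
  qed
  ultimately have "((\<lambda>y. integral {0..y} (gamma_density q)) \<longlongrightarrow> Gamma (1 / real q)) at_top"
    by simp
  then have "((\<lambda>y. 1 - integral {0..y} (gamma_density q) / Gamma (1 / real q)) \<longlongrightarrow> 0) at_top"
    using Gamma_inverse_pos by (auto intro!: tendsto_eq_intros)
  then show ?thesis
    by (rule Lim_transform_eventually)
       (auto simp: limit_shape_eq intro!: eventually_mono[OF eventually_ge_at_top[of 0]])
qed

lemma limit_shape_nonneg:
  assumes "0 \<le> x"
  shows "limit_shape q x \<ge> 0"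
proof (rule tendsto_upperbound[OF limit_shape_tendsto_0])
  show "\<forall>\<^sub>F y in at_top. limit_shape q y \<le> limit_shape q x"
    using eventually_ge_at_top[of x] by eventually_elim (use assms in \<open>rule limit_shape_antimono\<close>)
qed simp

end

text \<open>Riemann sums are compared with an antiderivative of the tail by the mean value theorem, so
  that the comparison telescopes and no integral occurs.\<close>

locale tail_antiderivative =
  fixes g G :: "real \<Rightarrow> real"
  assumes G_cont: "continuous_on {0..} G"
    and G_deriv: "\<And>x. x > 0 \<Longrightarrow> (G has_real_derivative - g x) (at x)"
    and G_lim: "(G \<longlongrightarrow> 0) at_top"
    and g_antimono: "\<And>x y. 0 \<le> x \<Longrightarrow> x \<le> y \<Longrightarrow> g y \<le> g x"
    and g_nonneg: "\<And>x. 0 \<le> x \<Longrightarrow> g x \<ge> 0"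
begin

lemma mean_value:
  assumes "0 \<le> x" "x < y"
  shows "(y - x) * g y \<le> G x - G y" "G x - G y \<le> (y - x) * g x"
proof -
  obtain \<xi> where \<xi>: "x < \<xi>" "\<xi> < y" "G y - G x = - g \<xi> * (y - x)"
  proof -
    have "\<exists>\<xi>\<in>{x<..<y}. G y - G x = (\<lambda>t. - g \<xi> * t) (y - x)"
    proof (rule mvt)
      show "continuous_on {x..y} G"
        using assms by (auto intro: continuous_on_subset[OF G_cont])
      fix t assume "x < t" "t < y"
      then show "(G has_derivative (\<lambda>u. - g t * u)) (at t)"
        using assms by (intro G_deriv[unfolded has_field_derivative_def]) auto
    qed (use assms in auto)
    then show ?thesis using that by auto
  qed
  then have eq: "G x - G y = (y - x) * g \<xi>" by (simp add: algebra_simps)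
  show "(y - x) * g y \<le> G x - G y" "G x - G y \<le> (y - x) * g x"
    unfolding eq using assms \<xi> by (auto intro!: mult_left_mono g_antimono)
qed

lemma G_antimono: "0 \<le> x \<Longrightarrow> x \<le> y \<Longrightarrow> G y \<le> G x"
proof (cases "x = y")
  case False
  assume "0 \<le> x" "x \<le> y"
  then have "(y - x) * g y \<le> G x - G y" "(y - x) * g y \<ge> 0"
    using False mean_value[of x y] g_nonneg[of y] by auto
  then show ?thesis by simp
qed simp

lemma G_telescope:
  assumes "h > 0"
  shows "(\<lambda>j. G (h * real (j + k)) - G (h * real (Suc (j + k)))) sums G (h * real k)"
proof -
  have "filterlim (\<lambda>j. h * real (j + k)) at_top sequentially"
    using assms
    by (intro filterlim_tendsto_pos_mult_at_top[OF tendsto_const]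
        filterlim_compose[OF filterlim_real_sequentially] filterlim_add_const_nat_at_top) auto
  then have "(\<lambda>j. G (h * real (j + k))) \<longlonglongrightarrow> 0"
    by (rule filterlim_compose[OF G_lim])
  then show ?thesis
    using telescope_sums'[of "\<lambda>j. G (h * real (j + k))" 0] by simp
qed

text \<open>The same term is compared with two cells: \<open>g\<close> at the right end of a cell is
  below its average there, and at the left end above it.\<close>

lemma riemann_step:
  assumes "h > 0"
  shows "h * g (h * real (Suc j)) \<le> G (h * real j) - G (h * real (Suc j))"
    and "G (h * real (Suc j)) - G (h * real (Suc (Suc j))) \<le> h * g (h * real (Suc j))"
  using assms mean_value[of "h * real j" "h * real (Suc j)"]
    mean_value[of "h * real (Suc j)" "h * real (Suc (Suc j))"]
  by (auto simp: algebra_simps)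

lemma riemann_sum_from:
  assumes h: "h > 0"
  shows "summable (\<lambda>j. g (h * real (Suc (j + k))))"
    and "h * (\<Sum>j. g (h * real (Suc (j + k)))) \<le> G (h * real k)"
    and "G (h * real (Suc k)) \<le> h * (\<Sum>j. g (h * real (Suc (j + k))))"
proof -
  have "summable (\<lambda>j. h * g (h * real (Suc (j + k))))"
  proof (rule summable_comparison_test'[OF sums_summable[OF G_telescope[OF h, of k]]])
    fix j
    have "h * g (h * real (Suc (j + k))) \<ge> 0" using h g_nonneg by simp
    then show "norm (h * g (h * real (Suc (j + k)))) \<le> G (h * real (j + k)) - G (h * real (Suc (j + k)))"
      using riemann_step(1)[OF h, of "j + k"] by (simp only: real_norm_def abs_of_nonneg)
  qed
  then show *: "summable (\<lambda>j. g (h * real (Suc (j + k))))"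
    using h by simp
  have s: "(\<lambda>j. h * g (h * real (Suc (j + k)))) sums (h * (\<Sum>j. g (h * real (Suc (j + k)))))"
    by (intro sums_mult summable_sums *)
  show "h * (\<Sum>j. g (h * real (Suc (j + k)))) \<le> G (h * real k)"
    by (rule sums_le[OF riemann_step(1)[OF h] s G_telescope[OF h]])
  show "G (h * real (Suc k)) \<le> h * (\<Sum>j. g (h * real (Suc (j + k))))"
    using sums_le[OF riemann_step(2)[OF h] G_telescope[OF h, of "Suc k", simplified add_Suc_right] s] .
qed

text \<open>A cutoff at \<open>c\<close> starts the sum within one mesh width of \<open>c\<close>,
  so both comparisons shift the argument of \<open>G\<close> by at most \<open>h\<close>. The
  \<open>max 0\<close> keeps that argument in the domain on which \<open>G\<close> is
  controlled.\<close>

lemma riemann_tail: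
  assumes h: "h > 0" and c: "c \<ge> 0"
  defines "f \<equiv> \<lambda>j. if c \<le> h * real (Suc j) then g (h * real (Suc j)) else 0"
  shows "summable f" "h * suminf f \<le> G (max 0 (c - h))" "G (c + h) \<le> h * suminf f"
proof -
  show sf: "summable f"
  proof (rule summable_comparison_test')
    show "summable (\<lambda>j. g (h * real (Suc j)))"
      using riemann_sum_from(1)[OF h, of 0] by simp
    have "g (h * real (Suc j)) \<ge> 0" for j
      using h by (intro g_nonneg) simp
    then show "norm (f j) \<le> g (h * real (Suc j))" for j
      by (simp add: f_def)
  qed
  define k where "k = (LEAST j. c \<le> h * real (Suc j))"
  have "\<exists>j. c \<le> h * real (Suc j)"
  proof -
    obtain n where "c / h \<le> real n" using real_arch_simple by blast
    then show ?thesis using h by (intro exI[of _ n]) (auto simp: field_simps)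
  qed
  then have k: "c \<le> h * real (Suc k)"
    unfolding k_def by (rule LeastI_ex)
  have lt: "h * real (Suc j) < c" if "j < k" for j
    using not_less_Least[of j "\<lambda>j. c \<le> h * real (Suc j)"] that by (simp add: k_def)
  have kc: "h * real k \<le> c"
    using lt[of "k - 1"] c by (cases k) auto
  have ge: "c \<le> h * real (Suc (j + k))" for j
  proof -
    have "h * real (Suc k) \<le> h * real (Suc (j + k))" using h by (intro mult_left_mono) auto
    with k show ?thesis by linarith
  qed
  have "suminf f = (\<Sum>j. f (j + k)) + (\<Sum>j<k. f j)"
    by (rule suminf_split_initial_segment[OF sf])
  also have "(\<Sum>j<k. f j) = 0"
    by (simp add: f_def lt[THEN not_le[THEN iffD2]] del: of_nat_Suc)
  also have "(\<lambda>j. f (j + k)) = (\<lambda>j. g (h * real (Suc (j + k))))"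
    by (simp only: f_def ge if_True)
  finally have eq: "suminf f = (\<Sum>j. g (h * real (Suc (j + k))))" by simp
  have "G (h * real k) \<le> G (max 0 (c - h))"
  proof (rule G_antimono)
    show "max 0 (c - h) \<le> h * real k"
      using k h by (simp add: algebra_simps)
  qed simp
  then show "h * suminf f \<le> G (max 0 (c - h))"
    unfolding eq using riemann_sum_from(2)[OF h, of k] by linarith
  have "G (c + h) \<le> G (h * real (Suc k))"
  proof (rule G_antimono)
    show "h * real (Suc k) \<le> c + h"
      using kc by (simp add: algebra_simps)
  qed (use h in simp)
  then show "G (c + h) \<le> h * suminf f"
    unfolding eq using riemann_sum_from(3)[OF h, of k] by linarith
qed

text \<open>The cutoff may move with \<open>i\<close>, since in the application it is the rescaled
  position of a fixed abscissa and is only known to converge.\<close>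

lemma riemann_tail_tendsto:
  assumes h: "(h \<longlongrightarrow> 0) F" "\<forall>\<^sub>F i in F. h i > 0"
    and c: "(c \<longlongrightarrow> c0) F" "\<forall>\<^sub>F i in F. c i \<ge> 0" and c0: "c0 \<ge> 0"
  shows "((\<lambda>i. h i * (\<Sum>j. if c i \<le> h i * real (Suc j) then g (h i * real (Suc j)) else 0)) \<longlongrightarrow> G c0) F"
proof (rule tendsto_sandwich)
  show "\<forall>\<^sub>F i in F. G (c i + h i) \<le> h i * (\<Sum>j. if c i \<le> h i * real (Suc j) then g (h i * real (Suc j)) else 0)"
    using h(2) c(2) by eventually_elim (rule riemann_tail)
  show "\<forall>\<^sub>F i in F. h i * (\<Sum>j. if c i \<le> h i * real (Suc j) then g (h i * real (Suc j)) else 0) \<le> G (max 0 (c i - h i))"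
    using h(2) c(2) by eventually_elim (rule riemann_tail)
  have "\<forall>\<^sub>F i in F. c i + h i \<in> {0..}"
    using h(2) c(2) by eventually_elim auto
  then show "((\<lambda>i. G (c i + h i)) \<longlongrightarrow> G c0) F"
    using c0 tendsto_add[OF c(1) h(1)] by (intro continuous_on_tendsto_compose[OF G_cont]) auto
  have "((\<lambda>i. max 0 (c i - h i)) \<longlongrightarrow> max 0 (c0 - 0)) F"
    by (intro tendsto_intros c h)
  then show "((\<lambda>i. G (max 0 (c i - h i))) \<longlongrightarrow> G c0) F"
    using c0 by (intro continuous_on_tendsto_compose[OF G_cont]) auto
qed

end

text \<open>For \<open>y \<ge> 0\<close> this is the integral of \<open>exp (- (s ^ q))\<close> over
  \<open>s \<ge> y\<close>, with the substitution \<open>u = s ^ q\<close> already carried out. Its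
  derivative and its limit at infinity confirm this without a change of variables under an
  integral.\<close>

definition exp_tail :: "nat \<Rightarrow> real \<Rightarrow> real" where
  "exp_tail q y = Gamma (1 / real q) / real q * limit_shape q (y ^ q)"

text \<open>The function \<open>y ^ q * exp (- (y ^ q))\<close> is not monotone; it is treated as the difference of the
  antitone functions \<open>(1 + y ^ q) * exp (- (y ^ q))\<close> and \<open>exp (- (y ^ q))\<close>.\<close>

definition power_exp_tail :: "nat \<Rightarrow> real \<Rightarrow> real" where
  "power_exp_tail q y = exp_tail q y + (exp_tail q y + y * exp (- (y ^ q))) / real q"

context
  fixes q :: nat
  assumes q: "q \<ge> 1"
begin

lemma exp_tail_0: "exp_tail q 0 = Gamma (1 / real q) / real q"
  using q limit_shape_0[OF q] by (simp add: exp_tail_def zero_power)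

lemma exp_tail_0_pos: "exp_tail q 0 > 0"
  using q Gamma_inverse_pos[OF q] by (simp add: exp_tail_0)

text \<open>This undoes the substitution and is the point where the limit of the Riemann sums turns
  into the limit shape.\<close>

lemma exp_tail_root: "x \<ge> 0 \<Longrightarrow> exp_tail q (root q x) = exp_tail q 0 * limit_shape q x"
  using q by (simp add: exp_tail_def exp_tail_0 limit_shape_0[OF q] zero_power)

text \<open>The boundary term of the integration by parts vanishes at 0. The excess over
  \<open>exp_tail q 0\<close> is the integral of \<open>y ^ q * exp (- (y ^ q))\<close> over the
  half-line, which is the source of the factor 1/q.\<close>

lemma power_exp_tail_0: "power_exp_tail q 0 = exp_tail q 0 + exp_tail q 0 / real q"
  by (simp add: power_exp_tail_def)

lemma exp_tail_continuous: "continuous_on {0..} (exp_tail q)"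
  unfolding exp_tail_def[abs_def]
  by (intro continuous_intros continuous_on_compose2[OF limit_shape_continuous[OF q]]) auto

lemma exp_tail_has_derivative:
  assumes y: "y > 0"
  shows "(exp_tail q has_real_derivative - exp (- (y ^ q))) (at y)"
proof -
  \<comment> \<open>The chain rule factor \<open>y ^ (q - 1)\<close> cancels the power in the Gamma
    density: the exponents are \<open>1 - q\<close> and \<open>q - 1\<close>.\<close>
  have "(y ^ q) powr (1 / real q - 1) * y ^ (q - 1) = (y powr real q) powr (1 / real q - 1) * y powr real (q - 1)"
    using y by (simp add: powr_realpow)
  also have "\<dots> = y powr (real q * (1 / real q - 1) + real (q - 1))"
    by (simp only: powr_powr powr_add)
  also have "real q * (1 / real q - 1) + real (q - 1) = 0"
    using q by (simp add: field_simps)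
  finally have *: "(y ^ q) powr (1 / real q - 1) * y ^ (q - 1) = 1"
    using y by simp
  have "((\<lambda>y. limit_shape q (y ^ q)) has_real_derivative
      - gamma_density q (y ^ q) / Gamma (1 / real q) * (real q * y ^ (q - 1))) (at y)"
    using y by (intro DERIV_chain2[OF limit_shape_has_derivative[OF q]]) (auto intro!: derivative_eq_intros)
  then have "(exp_tail q has_real_derivative Gamma (1 / real q) / real q *
      (- gamma_density q (y ^ q) / Gamma (1 / real q) * (real q * y ^ (q - 1)))) (at y)"
    unfolding exp_tail_def[abs_def] by (rule DERIV_cmult)
  also have "Gamma (1 / real q) / real q *
      (- gamma_density q (y ^ q) / Gamma (1 / real q) * (real q * y ^ (q - 1))) =
      - gamma_density q (y ^ q) * y ^ (q - 1)"
    using less_imp_neq[OF Gamma_inverse_pos[OF q]] q by simp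
  also have "\<dots> = - exp (- (y ^ q)) * ((y ^ q) powr (1 / real q - 1) * y ^ (q - 1))"
    by (simp add: gamma_density_def)
  finally show ?thesis
    using * by simp
qed

lemma exp_tail_tendsto_0: "(exp_tail q \<longlongrightarrow> 0) at_top"
proof -
  have "((\<lambda>y. limit_shape q (y ^ q)) \<longlongrightarrow> 0) at_top"
    using q by (intro filterlim_compose[OF limit_shape_tendsto_0[OF q]] filterlim_pow_at_top filterlim_ident) auto
  then show ?thesis
    unfolding exp_tail_def[abs_def] by (intro tendsto_mult_right_zero)
qed

lemma id_exp_power_tendsto_0: "((\<lambda>y::real. y * exp (- (y ^ q))) \<longlongrightarrow> 0) at_top"
proof (rule tendsto_sandwich[of "\<lambda>_. 0"])
  show "((\<lambda>y::real. y ^ 1 / exp y) \<longlongrightarrow> 0) at_top"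
    by (rule tendsto_power_div_exp_0)
  show "\<forall>\<^sub>F y::real in at_top. y * exp (- (y ^ q)) \<le> y ^ 1 / exp y"
    using eventually_ge_at_top[of 1]
  proof eventually_elim
    case (elim y)
    then have "y \<le> y ^ q" using self_le_power[of y q] q by auto
    then show ?case using elim by (auto simp: exp_minus divide_inverse intro!: mult_left_mono)
  qed
  show "\<forall>\<^sub>F y::real in at_top. 0 \<le> y * exp (- (y ^ q))"
    using eventually_ge_at_top[of 0] by eventually_elim auto
qed auto

lemma exp_tail_antiderivative: "tail_antiderivative (\<lambda>y. exp (- (y ^ q))) (exp_tail q)"
  by unfold_locales
    (auto simp: exp_tail_continuous exp_tail_has_derivative exp_tail_tendsto_0 intro: power_mono)

text \<open>The derivative of \<open>(1 + v) * exp (- v)\<close> is \<open>- v * exp (- v)\<close>.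
  The summand 1 matters, as \<open>v * exp (- v)\<close> increases up to
  \<open>v = 1\<close>.\<close>

lemma one_plus_mult_exp_antimono:
  fixes u v :: real
  assumes "0 \<le> u" "u \<le> v"
  shows "(1 + v) * exp (- v) \<le> (1 + u) * exp (- u)"
proof -
  have "(1 + v) \<le> (1 + u) * (1 + (v - u))"
    using assms by (simp add: algebra_simps mult_left_mono)
  also have "\<dots> \<le> (1 + u) * exp (v - u)"
    using assms by (intro mult_left_mono exp_ge_add_one_self) auto
  finally have "(1 + v) * exp (- v) \<le> (1 + u) * exp (v - u) * exp (- v)"
    by (rule mult_right_mono) simp
  then show ?thesis
    by (simp add: mult.assoc flip: exp_add)
qed

lemma power_exp_tail_antiderivative:
  "tail_antiderivative (\<lambda>y. (1 + y ^ q) * exp (- (y ^ q))) (power_exp_tail q)"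
proof
  show "continuous_on {0..} (power_exp_tail q)"
    unfolding power_exp_tail_def[abs_def] using q
    by (intro continuous_intros exp_tail_continuous) auto
  fix y :: real assume y: "y > 0"
  \<comment> \<open>The first summand cancels against the derivative of \<open>exp_tail\<close>; the
    second, divided by \<open>q\<close>, supplies the missing
    \<open>y ^ q * exp (- (y ^ q))\<close>.\<close>
  have "((\<lambda>y. y * exp (- (y ^ q))) has_real_derivative
      exp (- (y ^ q)) - real q * (y * y ^ (q - 1)) * exp (- (y ^ q))) (at y)"
    by (auto intro!: derivative_eq_intros simp: algebra_simps)
  also have "y * y ^ (q - 1) = y ^ q"
    using q by (cases q) auto
  finally have "(power_exp_tail q has_real_derivative
      - exp (- (y ^ q)) + (- exp (- (y ^ q)) + (exp (- (y ^ q)) - real q * y ^ q * exp (- (y ^ q)))) / real q) (at y)"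
    unfolding power_exp_tail_def[abs_def]
    by (intro DERIV_add DERIV_cdivide exp_tail_has_derivative y)
  then show "(power_exp_tail q has_real_derivative - ((1 + y ^ q) * exp (- (y ^ q)))) (at y)"
    using q by (simp add: field_simps)
next
  have "(power_exp_tail q \<longlongrightarrow> 0 + (0 + 0) / real q) at_top"
    unfolding power_exp_tail_def[abs_def] using q
    by (intro tendsto_intros exp_tail_tendsto_0 id_exp_power_tendsto_0) auto
  then show "(power_exp_tail q \<longlongrightarrow> 0) at_top" by simp
next
  fix x y :: real assume "0 \<le> x" "x \<le> y"
  then show "(1 + y ^ q) * exp (- (y ^ q)) \<le> (1 + x ^ q) * exp (- (x ^ q))"
    by (intro one_plus_mult_exp_antimono power_mono) auto
qed auto

end

section \<open>Calibration of the parameters\<close>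

context boltzmann_params
begin

text \<open>This is the mesh \<open>h\<close> with \<open>z1 = exp (- (h ^ q))\<close>: the odds of
  the part \<open>j ^ q\<close> are \<open>z2\<close> times \<open>exp (- (y ^ q))\<close> sampled
  at \<open>y = h * j\<close>.\<close>

definition scale :: real where "scale = root q (- ln z1)"

lemma scale_pos: "scale > 0"
  using q z1 by (simp add: scale_def)

lemma scale_power: "scale ^ q = - ln z1"
  using q z1 by (simp add: scale_def)

lemma odds_eq: "odds (qpow j) = z2 * exp (- ((scale * real (Suc j)) ^ q))"
proof -
  have "z1 ^ qpow j = exp (ln z1 * real (qpow j))"
    using z1 by (simp only: exp_of_nat2_mult exp_ln)
  also have "ln z1 * real (qpow j) = - ((scale * real (Suc j)) ^ q)"
    by (simp add: power_mult_distrib scale_power)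
  finally show ?thesis by (simp add: odds_def)
qed

lemma odds_le: "odds l \<le> z2"
  using z1 z2 by (simp add: odds_def power_le_one mult_left_le)

text \<open>Together with \<open>occ_le_odds\<close> this confines the quotient of odds and
  occupation probability to the interval from 1 to \<open>1 + z2\<close>, so the two agree
  asymptotically when \<open>z2\<close> tends to zero.\<close>

lemma occ_ge_odds: "odds l / (1 + z2) \<le> occ l"
  using odds_le[of l] odds_pos[of l] by (auto simp: occ_def intro!: divide_left_mono mult_pos_pos add_pos_pos z2)

lemma occ_le_1: "occ l \<le> 1"
  using odds_pos[of l] by (simp add: occ_def)

abbreviation "mean_len \<equiv> \<Sum>j. occ (qpow j)"
abbreviation "mean_weight \<equiv> \<Sum>j. real (qpow j) * occ (qpow j)"

interpretation e: tail_antiderivative "\<lambda>y. exp (- (y ^ q))" "exp_tail q"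
  using q by (rule exp_tail_antiderivative)

interpretation pe: tail_antiderivative "\<lambda>y. (1 + y ^ q) * exp (- (y ^ q))" "power_exp_tail q"
  using q by (rule power_exp_tail_antiderivative)

lemma mean_tail_bounds:
  assumes "c \<ge> 0" "\<And>j. R j \<longleftrightarrow> c \<le> scale * real (Suc j)"
  defines "S \<equiv> \<Sum>j. if c \<le> scale * real (Suc j) then exp (- ((scale * real (Suc j)) ^ q)) else 0"
  shows "(\<Sum>j. if R j then occ (qpow j) else 0) \<le> z2 * S"
    and "z2 * S / (1 + z2) \<le> (\<Sum>j. if R j then occ (qpow j) else 0)"
proof -
  let ?f = "\<lambda>j. if c \<le> scale * real (Suc j) then exp (- ((scale * real (Suc j)) ^ q)) else 0"
  have s: "summable ?f"
    using e.riemann_tail(1)[OF scale_pos assms(1)] .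
  have so: "summable (\<lambda>j. if R j then occ (qpow j) else 0)"
    by (rule summable_comparison_test'[OF summable_occ]) (auto simp: occ_nonneg)
  have "(\<Sum>j. if R j then occ (qpow j) else 0) \<le> (\<Sum>j. z2 * ?f j)"
    using occ_le_odds[of "qpow _"] assms(2)
    by (intro suminf_le so summable_mult s) (auto simp: odds_eq)
  then show "(\<Sum>j. if R j then occ (qpow j) else 0) \<le> z2 * S"
    unfolding S_def using s by (simp only: suminf_mult)
  have "(\<Sum>j. z2 * ?f j / (1 + z2)) \<le> (\<Sum>j. if R j then occ (qpow j) else 0)"
    using occ_ge_odds[of "qpow _"] assms(2)
    by (intro suminf_le so summable_mult summable_divide s) (auto simp: odds_eq)
  then show "z2 * S / (1 + z2) \<le> (\<Sum>j. if R j then occ (qpow j) else 0)"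
    unfolding S_def using s by (simp only: suminf_mult suminf_divide summable_mult)
qed

lemma summable_exp: "b > 0 \<Longrightarrow> summable (\<lambda>j. exp (- ((b * real (Suc j)) ^ q)))"
  using e.riemann_sum_from(1)[of b 0] by simp

lemma summable_power_exp:
  assumes "b > 0"
  shows "summable (\<lambda>j. (b * real (Suc j)) ^ q * exp (- ((b * real (Suc j)) ^ q)))"
proof -
  have "summable (\<lambda>j. (1 + (b * real (Suc j)) ^ q) * exp (- ((b * real (Suc j)) ^ q))
      - exp (- ((b * real (Suc j)) ^ q)))"
    using pe.riemann_sum_from(1)[of b 0] assms by (intro summable_diff summable_exp) auto
  then show ?thesis by (simp add: algebra_simps)
qed

lemma mean_weight_bounds:
  defines "S \<equiv> \<Sum>j. (scale * real (Suc j)) ^ q * exp (- ((scale * real (Suc j)) ^ q))"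
  shows "summable (\<lambda>j. real (qpow j) * occ (qpow j))"
    and "scale ^ q * mean_weight \<le> z2 * S"
    and "z2 * S / (1 + z2) \<le> scale ^ q * mean_weight"
proof -
  let ?f = "\<lambda>j. (scale * real (Suc j)) ^ q * exp (- ((scale * real (Suc j)) ^ q))"
  have s: "summable ?f"
    by (rule summable_power_exp[OF scale_pos])
  have eq: "scale ^ q * (real (qpow j) * occ (qpow j)) = (scale * real (Suc j)) ^ q * occ (qpow j)" for j
    by (simp add: power_mult_distrib)
  have nn: "(scale * real (Suc j)) ^ q \<ge> 0" for j using scale_pos by simp
  have up: "scale ^ q * (real (qpow j) * occ (qpow j)) \<le> z2 * ?f j" for j
    unfolding eq using mult_left_mono[OF occ_le_odds[of "qpow j"] nn[of j]] by (simp add: odds_eq mult_ac)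
  have "summable (\<lambda>j. scale ^ q * (real (qpow j) * occ (qpow j)))"
  proof (rule summable_comparison_test'[OF summable_mult[OF s, of z2]])
    fix j
    have "scale ^ q * (real (qpow j) * occ (qpow j)) \<ge> 0"
      unfolding eq using nn occ_nonneg by simp
    then show "norm (scale ^ q * (real (qpow j) * occ (qpow j))) \<le> z2 * ?f j"
      using up[of j] by (simp only: real_norm_def abs_of_nonneg)
  qed
  then show sw: "summable (\<lambda>j. real (qpow j) * occ (qpow j))"
    using scale_pos by simp
  have mw: "scale ^ q * mean_weight = (\<Sum>j. scale ^ q * (real (qpow j) * occ (qpow j)))"
    by (rule suminf_mult[symmetric, OF sw])
  have "scale ^ q * mean_weight \<le> (\<Sum>j. z2 * ?f j)"
    unfolding mw by (intro suminf_le up summable_mult sw s)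
  then show "scale ^ q * mean_weight \<le> z2 * S"
    unfolding S_def using s by (simp only: suminf_mult)
  have lo: "z2 * ?f j / (1 + z2) \<le> scale ^ q * (real (qpow j) * occ (qpow j))" for j
    unfolding eq using mult_left_mono[OF occ_ge_odds[of "qpow j"] nn[of j]] by (simp add: odds_eq mult_ac)
  have "(\<Sum>j. z2 * ?f j / (1 + z2)) \<le> scale ^ q * mean_weight"
    unfolding mw by (intro suminf_le lo summable_mult summable_divide sw s)
  then show "z2 * S / (1 + z2) \<le> scale ^ q * mean_weight"
    unfolding S_def using s by (simp only: suminf_mult suminf_divide summable_mult)
qed

text \<open>For bounded \<open>z2\<close> and expected length tending to infinity, this forces
  \<open>scale\<close> to zero.\<close>

lemma scale_mean_len_le: "scale * mean_len \<le> z2 * exp_tail q 0"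
proof -
  have "mean_len \<le> (\<Sum>j. z2 * exp (- ((scale * real (Suc j)) ^ q)))"
    using occ_le_odds[of "qpow _"]
    by (intro suminf_le summable_occ summable_mult summable_exp scale_pos) (auto simp: odds_eq)
  then have "mean_len \<le> z2 * (\<Sum>j. exp (- ((scale * real (Suc j)) ^ q)))"
    using summable_exp[OF scale_pos] by (simp only: suminf_mult)
  then have "scale * mean_len \<le> z2 * (scale * (\<Sum>j. exp (- ((scale * real (Suc j)) ^ q))))"
    using scale_pos by (simp add: mult_left_mono mult.left_commute[of z2])
  also have "\<dots> \<le> z2 * exp_tail q 0"
    using e.riemann_sum_from(2)[OF scale_pos, of 0] z2 by (intro mult_left_mono) auto
  finally show ?thesis .
qed

text \<open>In terms of \<open>t = - ln z1 * l\<close>, the probability is at most 1 and at most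
  \<open>exp (\<sigma> - 1 - t)\<close>, so the plateau has width about \<open>\<sigma>\<close>.
  Both bounds are dominated by \<open>exp (1 - t / \<sigma>)\<close>: the first for
  \<open>t \<le> \<sigma>\<close>, the second beyond. The result is an exponential bound on the
  stretched scale whose prefactor does not depend on \<open>z2\<close>.\<close>

lemma occ_stretched_le:
  fixes \<sigma> :: real
  defines "\<sigma> \<equiv> 1 + max 0 (ln z2)"
  shows "occ l \<le> exp 1 * exp (ln z1 * real l / \<sigma>)"
proof -
  define t where "t = - ln z1 * real l"
  have t: "t \<ge> 0" using z1 by (simp add: t_def mult_nonpos_nonneg)
  have \<sigma>: "\<sigma> \<ge> 1" by (simp add: \<sigma>_def)
  have z1l: "z1 ^ l = exp (- t)"
    using z1 by (simp add: t_def mult.commute exp_of_nat_mult)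
  have "z2 \<le> exp (\<sigma> - 1)"
    using z2 by (metis \<sigma>_def add_diff_cancel_left' exp_le_cancel_iff exp_ln max.cobounded2)
  then have "odds l \<le> exp (\<sigma> - 1) * exp (- t)"
    by (simp add: odds_def z1l)
  then have o1: "occ l \<le> exp (\<sigma> - 1 - t)"
    using occ_le_odds[of l] by (simp add: exp_diff exp_minus divide_inverse)
  have "occ l \<le> exp (1 - t / \<sigma>)"
  proof (cases "t \<le> \<sigma>")
    case True
    then have "0 \<le> 1 - t / \<sigma>" using \<sigma> by (simp add: field_simps)
    then have "1 \<le> exp (1 - t / \<sigma>)" by simp
    then show ?thesis using occ_le_1[of l] by linarith
  next
    case False
    have "(\<sigma> - 1) * \<sigma> \<le> (\<sigma> - 1) * t"
      using False \<sigma> by (intro mult_left_mono) auto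
    then have "\<sigma> - 1 - t \<le> 1 - t / \<sigma>"
      using \<sigma> by (simp add: field_simps)
    then show ?thesis using o1 by (meson exp_le_cancel_iff order_trans)
  qed
  then show ?thesis
    by (simp add: t_def exp_diff exp_minus divide_inverse flip: exp_add)
qed

text \<open>On the stretched mesh \<open>b\<close>, Riemann sums bound
  \<open>b ^ (q + 1) * mean_weight\<close>. Conversely, the roughly \<open>1 / b\<close> smallest
  parts are each present with probability bounded below, so \<open>1 / b\<close> is at most a
  constant times \<open>mean_len\<close>. Eliminating \<open>b\<close> gives the claim. The
  hypothesis \<open>large\<close> yields \<open>b \<le> 1\<close>.\<close>

lemma mean_weight_le_if_large_fugacity:
  assumes \<delta>: "0 < \<delta>" "\<delta> \<le> 1" "\<delta> \<le> z2" and large: "exp 1 * exp_tail q 0 \<le> mean_len"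
  shows "mean_weight \<le> exp 1 * power_exp_tail q 0 * (2 * (1 + \<delta> / exp 1) / (\<delta> / exp 1) * mean_len) ^ (q + 1)"
proof -
  define \<sigma> where "\<sigma> = 1 + max 0 (ln z2)"
  have \<sigma>: "\<sigma> \<ge> 1" by (simp add: \<sigma>_def)
  define b where "b = root q (- ln z1 / \<sigma>)"
  have b: "b > 0" and bq: "b ^ q = - ln z1 / \<sigma>"
    using q z1 \<sigma> by (simp_all add: b_def divide_neg_pos divide_nonpos_pos)
  define n where "n j = real (Suc j)" for j
  have occ_le: "occ (qpow j) \<le> exp 1 * exp (- ((b * n j) ^ q))" for j
    using occ_stretched_le[of "qpow j"] by (simp add: power_mult_distrib bq n_def flip: \<sigma>_def)
  have se: "summable (\<lambda>j. exp (- ((b * n j) ^ q)))"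
    unfolding n_def by (rule summable_exp[OF b])
  have spe: "summable (\<lambda>j. (1 + (b * n j) ^ q) * exp (- ((b * n j) ^ q)))"
    unfolding n_def using pe.riemann_sum_from(1)[OF b, of 0] by simp
  have "mean_len \<le> (\<Sum>j. exp 1 * exp (- ((b * n j) ^ q)))"
    by (intro suminf_le occ_le summable_mult summable_occ se)
  also have "\<dots> = exp 1 * (\<Sum>j. exp (- ((b * n j) ^ q)))"
    by (rule suminf_mult[OF se])
  finally have "b * mean_len \<le> b * (exp 1 * (\<Sum>j. exp (- ((b * n j) ^ q))))"
    using b by (intro mult_left_mono) auto
  also have "\<dots> = exp 1 * (b * (\<Sum>j. exp (- ((b * n j) ^ q))))"
    by (simp add: mult_ac)
  also have "\<dots> \<le> exp 1 * exp_tail q 0"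
    unfolding n_def using e.riemann_sum_from(2)[OF b, of 0] by (intro mult_left_mono) auto
  finally have "b * mean_len \<le> mean_len" using large by linarith
  moreover have "mean_len > 0"
    using large mult_pos_pos[OF exp_gt_zero[of 1] exp_tail_0_pos[OF q]] by linarith
  ultimately have b1: "b \<le> 1" by simp
  have weight: "b ^ (q + 1) * mean_weight \<le> exp 1 * power_exp_tail q 0"
  proof -
    have le: "b ^ q * (real (qpow j) * occ (qpow j)) \<le> exp 1 * ((1 + (b * n j) ^ q) * exp (- ((b * n j) ^ q)))" for j
    proof -
      have "b ^ q * (real (qpow j) * occ (qpow j)) = (b * n j) ^ q * occ (qpow j)"
        by (simp add: power_mult_distrib n_def)
      \<comment> \<open>Enlarging the factor by 1 makes the summand antitone, as the Riemann bound
        demands.\<close>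
      also have "\<dots> \<le> (1 + (b * n j) ^ q) * (exp 1 * exp (- ((b * n j) ^ q)))"
        using b occ_nonneg by (intro mult_mono occ_le) (auto simp: n_def)
      finally show ?thesis by (simp add: mult_ac)
    qed
    have "b ^ q * mean_weight = (\<Sum>j. b ^ q * (real (qpow j) * occ (qpow j)))"
      by (rule suminf_mult[symmetric, OF mean_weight_bounds(1)])
    also have "\<dots> \<le> (\<Sum>j. exp 1 * ((1 + (b * n j) ^ q) * exp (- ((b * n j) ^ q))))"
      by (intro suminf_le le summable_mult mean_weight_bounds(1) spe)
    also have "\<dots> = exp 1 * (\<Sum>j. (1 + (b * n j) ^ q) * exp (- ((b * n j) ^ q)))"
      by (rule suminf_mult[OF spe])
    finally have "b * (b ^ q * mean_weight) \<le> b * (exp 1 * (\<Sum>j. (1 + (b * n j) ^ q) * exp (- ((b * n j) ^ q))))"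
      using b by (intro mult_left_mono) auto
    also have "\<dots> = exp 1 * (b * (\<Sum>j. (1 + (b * n j) ^ q) * exp (- ((b * n j) ^ q))))"
      by (simp add: mult_ac)
    also have "\<dots> \<le> exp 1 * power_exp_tail q 0"
      unfolding n_def using pe.riemann_sum_from(2)[OF b, of 0] by (intro mult_left_mono) auto
    finally show ?thesis by (simp add: mult_ac)
  qed
  \<comment> \<open>A lower bound for \<open>z2 * exp (- \<sigma>)\<close>, which is
    \<open>z2 / exp 1\<close> if \<open>z2 \<le> 1\<close> and \<open>1 / exp 1\<close>
    otherwise.\<close>
  define r where "r = \<delta> / exp 1"
  have r: "r > 0" using \<delta> by (simp add: r_def)
  \<comment> \<open>The indices below \<open>m\<close> have \<open>b * n j \<le> 1\<close>, where
    the odds are still at least \<open>z2 * exp (- \<sigma>)\<close>.\<close>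
  define m where "m = nat \<lfloor>1 / b\<rfloor>"
  have m: "real m \<le> 1 / b" "1 / b < real m + 1" "1 \<le> m"
    using b b1 by (auto simp: m_def le_nat_iff nat_le_iff)
  have occ_ge: "r / (1 + r) \<le> occ (qpow j)" if "j < m" for j
  proof -
    have "n j \<le> real m" using that by (simp add: n_def)
    then have "b * n j \<le> 1"
      using m(1) b by (metis le_divide_eq mult.commute order_trans)
    then have "(b * n j) ^ q \<le> 1"
      using b by (intro power_le_one) (auto simp: n_def)
    then have "- ln z1 / \<sigma> * n j ^ q \<le> 1"
      by (simp add: power_mult_distrib bq)
    then have "- ln z1 * n j ^ q \<le> \<sigma>"
      using \<sigma> by (simp add: field_simps)
    then have "z2 * exp (- \<sigma>) \<le> odds (qpow j)"
      using z2 by (simp add: odds_eq power_mult_distrib scale_power n_def)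
    moreover have "r \<le> z2 * exp (- \<sigma>)"
    proof (cases "z2 \<le> 1")
      case True
      then have "\<sigma> = 1" using z2 by (simp add: \<sigma>_def)
      then show ?thesis using \<delta> by (simp add: r_def exp_minus divide_inverse)
    next
      case False
      then have "\<sigma> = 1 + ln z2" by (simp add: \<sigma>_def)
      then have "exp \<sigma> = exp 1 * z2" using z2 by (simp add: exp_add)
      then show ?thesis using \<delta> z2 by (simp add: r_def exp_minus field_simps)
    qed
    ultimately have "r \<le> odds (qpow j)" by linarith
    then show ?thesis
      using r odds_pos[of "qpow j"] by (simp add: occ_def field_simps)
  qed
  have "real m * (r / (1 + r)) \<le> (\<Sum>j<m. occ (qpow j))"
    using sum_bounded_below[of "{..<m}" "r / (1 + r)" "\<lambda>j. occ (qpow j)"] occ_ge by simp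
  also have "\<dots> \<le> mean_len"
    by (intro sum_le_suminf summable_occ) (auto simp: occ_nonneg)
  finally have "real m \<le> (1 + r) / r * mean_len"
    using r by (simp add: field_simps)
  \<comment> \<open>Rounding down costs at most a factor 2 because \<open>m \<ge> 1\<close>; hence
    the 2 in the statement.\<close>
  moreover have "1 / b \<le> 2 * real m" using m by linarith
  ultimately have "1 / b \<le> 2 * ((1 + r) / r * mean_len)" by linarith
  then have "1 / b \<le> 2 * (1 + r) / r * mean_len"
    by (simp only: times_divide_eq_right times_divide_eq_left mult.assoc)
  then have "(1 / b) ^ (q + 1) \<le> (2 * (1 + r) / r * mean_len) ^ (q + 1)"
    using b by (intro power_mono) auto
  moreover have "power_exp_tail q 0 \<ge> 0"
    using exp_tail_0_pos[OF q] by (simp add: power_exp_tail_0[OF q])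
  ultimately have "exp 1 * power_exp_tail q 0 * (1 / b) ^ (q + 1)
      \<le> exp 1 * power_exp_tail q 0 * (2 * (1 + r) / r * mean_len) ^ (q + 1)"
    by (intro mult_left_mono) auto
  moreover have "mean_weight \<le> exp 1 * power_exp_tail q 0 * (1 / b) ^ (q + 1)"
    using weight b by (simp add: field_simps power_one_over)
  ultimately show ?thesis by (simp add: r_def)
qed

end

lemma boltzmann_params_of_calibrated:
  assumes "q \<ge> 1" "calibrated q N M z1 z2"
  shows "boltzmann_params q z1 z2"
  using assms by unfold_locales (auto simp: calibrated_def)

section \<open>Calibrated means and deviations of the boundary\<close>

context boltzmann_params
begin

lemma calibrated_means:
  assumes "calibrated q N M z1 z2"
  shows "N = mean_weight" "M = mean_len"
proof -
  have "N = expectation (\<lambda>p. real (weight p))"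
    using assms by (simp add: calibrated_def)
  also have "\<dots> = expectation (\<lambda>p. \<Sum>l\<in>set p. real l)"
    by (intro Bochner_Integration.integral_cong) (auto simp: weight_strict)
  also have "\<dots> = mean_weight"
    by (rule expectation_additive[OF _ mean_weight_bounds(1)]) simp
  finally show "N = mean_weight" .
  have "M = expectation (\<lambda>p. real (len p))"
    using assms by (simp add: calibrated_def)
  also have "\<dots> = expectation (\<lambda>p. \<Sum>l\<in>set p. 1)"
    by (intro Bochner_Integration.integral_cong) (auto simp: len_strict)
  also have "\<dots> = (\<Sum>j. 1 * occ (qpow j))"
    by (rule expectation_additive) (use summable_occ in auto)
  finally show "M = mean_len" by simp
qed

text \<open>This series is the expectation of \<open>young_boundary p x\<close>.\<close>

definition mean_tail :: "real \<Rightarrow> real" where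
  "mean_tail x = (\<Sum>j. if x \<le> real (qpow j) then occ (qpow j) else 0)"

lemma mean_tail_le: "mean_tail x \<le> mean_len"
  unfolding mean_tail_def
  by (intro suminf_le summable_occ summable_comparison_test'[OF summable_occ]) (auto simp: occ_nonneg)

lemma young_boundary_deviation:
  assumes "a > 0"
  shows "prob {p \<in> SP. \<bar>young_boundary p x - mean_tail x\<bar> \<ge> a} \<le> mean_len / a\<^sup>2"
proof -
  let ?c = "indicator {l. x \<le> real l} :: nat \<Rightarrow> real"
  have t: "(\<Sum>j. ?c (qpow j) * occ (qpow j)) = mean_tail x"
    unfolding mean_tail_def by (intro suminf_cong) (simp add: indicator_def)
  have "{p \<in> SP. \<bar>young_boundary p x - mean_tail x\<bar> \<ge> a} = {p \<in> SP. \<bar>(\<Sum>l\<in>set p. ?c l) - mean_tail x\<bar> \<ge> a}"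
    by (intro Collect_cong conj_cong) (auto simp: young_boundary_strict indicator_def of_bool_def)
  then have "prob {p \<in> SP. \<bar>young_boundary p x - mean_tail x\<bar> \<ge> a} \<le> mean_tail x / a\<^sup>2"
    using count_deviation[OF assms, of "{l. x \<le> real l}"] by (simp only: t)
  also have "\<dots> \<le> mean_len / a\<^sup>2"
    by (intro divide_right_mono mean_tail_le) simp
  finally show ?thesis .
qed

end

lemma scaled_boundary_antimono:
  assumes "N > 0" "M > 0" "x \<le> y"
  shows "scaled_boundary q N M p y \<le> scaled_boundary q N M p x"
proof -
  have "real q * N / M * x \<le> real q * N / M * y"
    using assms by (intro mult_left_mono) auto
  then have "young_boundary p (real q * N / M * y) \<le> young_boundary p (real q * N / M * x)"
    unfolding young_boundary_def by (intro of_nat_mono sum_mono2) auto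
  then show ?thesis
    using assms by (simp add: scaled_boundary_def divide_right_mono)
qed

lemma scaled_boundary_nonneg: "M > 0 \<Longrightarrow> scaled_boundary q N M p x \<ge> 0"
  by (auto simp: scaled_boundary_def young_boundary_def intro!: divide_nonneg_pos sum_nonneg)

section \<open>Uniform convergence\<close>

text \<open>Pointwise closeness of antitone functions to a continuous antitone limit upgrades to uniform
  closeness, the grid being formed by points where the limit takes the values \<open>1 - k / n\<close>.\<close>

lemma uniform_grid:
  fixes \<phi> :: "real \<Rightarrow> real"
  assumes cont: "continuous_on {0..} \<phi>" and anti: "\<And>x y. 0 \<le> x \<Longrightarrow> x \<le> y \<Longrightarrow> \<phi> y \<le> \<phi> x"
    and \<phi>0: "\<phi> 0 = 1" and lim: "(\<phi> \<longlongrightarrow> 0) at_top" and nonneg: "\<And>x. 0 \<le> x \<Longrightarrow> \<phi> x \<ge> 0"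
    and \<epsilon>: "\<epsilon> > 0"
  obtains C where "finite C" "C \<subseteq> {0..}"
    "\<And>f. (\<And>x y. 0 \<le> x \<Longrightarrow> x \<le> y \<Longrightarrow> f y \<le> f x) \<Longrightarrow> (\<And>x. f x \<ge> 0) \<Longrightarrow>
      (\<And>c. c \<in> C \<Longrightarrow> \<bar>f c - \<phi> c\<bar> < \<epsilon> / 2) \<Longrightarrow> \<forall>x\<ge>0. \<bar>f x - \<phi> x\<bar> \<le> \<epsilon>"
proof -
  obtain n :: nat where n: "n > 0" "1 / real n \<le> \<epsilon> / 2"
  proof -
    obtain n :: nat where "n > 0" "inverse (real n) < \<epsilon> / 2"
      using ex_inverse_of_nat_less[of "\<epsilon> / 2"] \<epsilon> by auto
    then show ?thesis using that by (simp add: inverse_eq_divide)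
  qed
  have "\<exists>x\<ge>0. \<phi> x = 1 - real k / real n" if "k < n" for k
  proof -
    have pos: "1 - real k / real n > 0" using that n by (simp add: field_simps)
    have "\<forall>\<^sub>F b in at_top. \<phi> b < 1 - real k / real n \<and> 0 \<le> b"
      using order_tendstoD(2)[OF lim pos] eventually_ge_at_top[of 0] by eventually_elim auto
    then obtain b where "\<phi> b < 1 - real k / real n" "0 \<le> b"
      using eventually_happens by (metis (no_types, lifting) trivial_limit_at_top_linorder)
    then have "\<exists>x\<ge>0. x \<le> b \<and> \<phi> x = 1 - real k / real n"
      using \<phi>0 by (intro IVT2' continuous_on_subset[OF cont]) auto
    then show ?thesis by blast
  qed
  then obtain X where X: "\<And>k. k < n \<Longrightarrow> X k \<ge> 0" "\<And>k. k < n \<Longrightarrow> \<phi> (X k) = 1 - real k / real n"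
    by metis
  \<comment> \<open>The limit may equal 1 at a grid point other than 0, so 0 is added to bound
    \<open>f\<close> at arguments left of that point.\<close>
  let ?C = "insert 0 (X ` {..<n})"
  show thesis
  proof (rule that)
    show "finite ?C" "?C \<subseteq> {0..}" using X by auto
    fix f :: "real \<Rightarrow> real"
    assume f: "\<And>x y. 0 \<le> x \<Longrightarrow> x \<le> y \<Longrightarrow> f y \<le> f x" "\<And>x. f x \<ge> 0"
      and close: "\<And>c. c \<in> ?C \<Longrightarrow> \<bar>f c - \<phi> c\<bar> < \<epsilon> / 2"
    have closeX: "\<bar>f (X k) - \<phi> (X k)\<bar> < \<epsilon> / 2" if "k < n" for k
      by (rule close) (use that in auto)
    show "\<forall>x\<ge>0. \<bar>f x - \<phi> x\<bar> \<le> \<epsilon>"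
    proof (intro allI impI)
      fix x :: real assume x: "x \<ge> 0"
      \<comment> \<open>The value of the limit at \<open>x\<close>, expressed as a fractional index
        of the levels \<open>1 - k / n\<close>.\<close>
      define y where "y = (1 - \<phi> x) * real n"
      have v: "0 \<le> \<phi> x" "\<phi> x \<le> 1" using x nonneg anti[of 0 x] \<phi>0 by auto
      have y: "0 \<le> y" "y \<le> real n" using v n by (auto simp: y_def mult_left_le_one_le)
      have vy: "\<phi> x = 1 - y / real n" using n by (simp add: y_def)
      have "f x \<le> \<phi> x + \<epsilon>"
      proof (cases "y = 0")
        case True
        then have "\<phi> x = \<phi> 0" using \<phi>0 vy by simp
        moreover have "f x \<le> f 0" using f(1) x by simp
        moreover have "\<bar>f 0 - \<phi> 0\<bar> < \<epsilon> / 2" by (rule close) simp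
        ultimately show ?thesis using \<epsilon> by linarith
      next
        case False
        \<comment> \<open>The largest integer strictly below \<open>y\<close>. Strictness gives
          \<open>\<phi> (X k) > \<phi> x\<close>, from which antitonicity places \<open>X k\<close>
          to the left of \<open>x\<close>.\<close>
        define k where "k = nat (\<lceil>y\<rceil> - 1)"
        have k: "real k < y" "y \<le> real k + 1"
          using False y by (auto simp: k_def) linarith+
        have kn: "k < n" using k y by linarith
        have "\<phi> (X k) > \<phi> x"
          using X(2)[OF kn] vy k n by (simp add: divide_strict_right_mono)
        then have "X k \<le> x" using anti[of x "X k"] x by force
        then have "f x \<le> f (X k)" using f(1) X(1)[OF kn] by auto
        also have "\<dots> \<le> \<phi> (X k) + \<epsilon> / 2" using closeX[OF kn] by linarith
        also have "\<phi> (X k) \<le> \<phi> x + 1 / real n"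
        proof -
          have "(y - real k) / real n \<le> 1 / real n" using k by (intro divide_right_mono) auto
          then show ?thesis using X(2)[OF kn] vy by (simp add: diff_divide_distrib)
        qed
        finally show ?thesis using n by linarith
      qed
      moreover have "\<phi> x - \<epsilon> \<le> f x"
      proof -
        define k where "k = nat \<lfloor>y\<rfloor> + 1"
        have k: "y < real k" "real k \<le> y + 1"
          using y by (auto simp: k_def) linarith+
        have low: "\<phi> x - 1 / real n \<le> 1 - real k / real n"
        proof -
          have "(real k - y) / real n \<le> 1 / real n" using k by (intro divide_right_mono) auto
          then show ?thesis using vy by (simp add: diff_divide_distrib)
        qed
        show ?thesis
        proof (cases "k < n")
          case True
          have "\<phi> (X k) < \<phi> x"
            using X(2)[OF True] vy k n by (simp add: divide_strict_right_mono)
          then have "x \<le> X k" using anti[of "X k" x] X(1)[OF True] by force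
          then have "f (X k) \<le> f x" using f(1) x by auto
          moreover have "\<phi> (X k) - \<epsilon> / 2 \<le> f (X k)" using closeX[OF True] by linarith
          ultimately show ?thesis using low X(2)[OF True] n by linarith
        next
          \<comment> \<open>The level 0 has no grid point; there
            \<open>\<phi> x \<le> 1 / n\<close>, and nonnegativity of \<open>f\<close>
            suffices.\<close>
          case False
          then have "1 \<le> real k / real n" using n by simp
          then have "\<phi> x \<le> 1 / real n" using low by linarith
          then show ?thesis using n f(2)[of x] \<epsilon> by linarith
        qed
      qed
      ultimately show "\<bar>f x - \<phi> x\<bar> \<le> \<epsilon>" by linarith
    qed
  qed
qed

text \<open>An arbitrary filter covers sequences as well as a joint limit in two independent
  hyper-parameters.\<close>

locale calibrated_regime =
  fixes q :: nat and N M z1 z2 :: "'i \<Rightarrow> real" and F :: "'i filter"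
  assumes q: "q \<ge> 1"
    and N: "filterlim N at_top F"
    and M: "filterlim M at_top F"
    and \<kappa>: "((\<lambda>i. M i ^ (q + 1) / N i) \<longlongrightarrow> 0) F"
    and cal: "\<forall>\<^sub>F i in F. calibrated q (N i) (M i) (z1 i) (z2 i)"
begin

abbreviation "E0 \<equiv> exp_tail q 0"
abbreviation "h i \<equiv> boltzmann_params.scale q (z1 i)"

lemma eventually_params:
  "\<forall>\<^sub>F i in F. boltzmann_params q (z1 i) (z2 i) \<and> calibrated q (N i) (M i) (z1 i) (z2 i)"
  using cal by eventually_elim (auto intro: boltzmann_params_of_calibrated[OF q])

lemma eventually_N_ge: "\<forall>\<^sub>F i in F. c \<le> N i"
  using N by (simp add: filterlim_at_top)

lemma eventually_M_ge: "\<forall>\<^sub>F i in F. c \<le> M i"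
  using M by (simp add: filterlim_at_top)

lemma fugacity_small:
  assumes "0 < \<delta>" "\<delta> \<le> 1"
  shows "\<forall>\<^sub>F i in F. z2 i < \<delta>"
proof -
  \<comment> \<open>The constant of \<open>mean_weight_le_if_large_fugacity\<close> with the power
    of \<open>mean_len\<close> split off. A fugacity of at least \<open>\<delta>\<close> would give
    \<open>N \<le> K * M ^ (q + 1)\<close>, against the smallness of the quotient.\<close>
  define K where "K = exp 1 * power_exp_tail q 0 * (2 * (1 + \<delta> / exp 1) / (\<delta> / exp 1)) ^ (q + 1)"
  have "power_exp_tail q 0 > 0"
    using exp_tail_0_pos[OF q] by (simp add: power_exp_tail_0[OF q] add_pos_nonneg)
  then have K: "K > 0"
    unfolding K_def using assms
    by (intro mult_pos_pos divide_pos_pos add_pos_pos zero_less_power) auto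
  have "\<forall>\<^sub>F i in F. M i ^ (q + 1) / N i < 1 / K"
    using K by (intro order_tendstoD(2)[OF \<kappa>]) auto
  with eventually_params eventually_N_ge[of 1] eventually_M_ge[of "exp 1 * E0"]
  show ?thesis
  proof eventually_elim
    case (elim i)
    then interpret boltzmann_params q "z1 i" "z2 i" by blast
    note means = calibrated_means[OF conjunct2[OF elim(1)]]
    show ?case
    proof (rule ccontr)
      assume "\<not> z2 i < \<delta>"
      then have "mean_weight \<le> K * mean_len ^ (q + 1)"
        using mean_weight_le_if_large_fugacity[of \<delta>] assms elim
        by (simp only: K_def means power_mult_distrib mult.assoc not_less)
      then have "N i \<le> K * M i ^ (q + 1)" by (simp only: means)
      then show False
        using elim K by (simp add: field_simps)
    qed
  qed
qed

lemma fugacity_pos: "\<forall>\<^sub>F i in F. z2 i > 0"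
  using cal by eventually_elim (simp add: calibrated_def)

lemma fugacity_tendsto_0: "(z2 \<longlongrightarrow> 0) F"
proof (rule order_tendstoI)
  show "\<forall>\<^sub>F i in F. a < z2 i" if "a < 0" for a
    using fugacity_pos by eventually_elim (use that in auto)
  show "\<forall>\<^sub>F i in F. z2 i < a" if "0 < a" for a
    using fugacity_small[of "min a 1"] that by (auto elim: eventually_mono)
qed

lemma scale_pos: "\<forall>\<^sub>F i in F. h i > 0"
  using eventually_params by eventually_elim (auto intro: boltzmann_params.scale_pos)

lemma scale_tendsto_0: "(h \<longlongrightarrow> 0) F"
proof (rule tendsto_sandwich)
  show "\<forall>\<^sub>F i in F. 0 \<le> h i"
    using scale_pos by eventually_elim simp
  show "\<forall>\<^sub>F i in F. h i \<le> E0 / M i"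
    using eventually_params fugacity_small[of 1, simplified] eventually_M_ge[of 1]
  proof eventually_elim
    case (elim i)
    then interpret boltzmann_params q "z1 i" "z2 i" by blast
    have "scale * M i \<le> z2 i * E0"
      using scale_mean_len_le calibrated_means(2)[OF conjunct2[OF elim(1)]] by simp
    also have "\<dots> \<le> E0"
      using elim z2 exp_tail_0_pos[OF q] by (intro mult_left_le_one_le) auto
    finally show ?case using elim by (simp add: field_simps)
  qed
  show "((\<lambda>i. E0 / M i) \<longlongrightarrow> 0) F"
    by (rule real_tendsto_divide_at_top[OF tendsto_const M])
qed auto

text \<open>Since the fugacity \<open>z2\<close> tends to zero, the occupation probability of a part is asymptotically
  its odds.\<close>

lemma occ_odds_sandwich:
  assumes S: "(S \<longlongrightarrow> L) F"
    and up: "\<forall>\<^sub>F i in F. T i \<le> z2 i * S i" and low: "\<forall>\<^sub>F i in F. z2 i * S i / (1 + z2 i) \<le> T i"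
  shows "((\<lambda>i. T i / z2 i) \<longlongrightarrow> L) F"
proof (rule tendsto_sandwich)
  show "\<forall>\<^sub>F i in F. T i / z2 i \<le> S i"
    using up fugacity_pos by eventually_elim (simp add: field_simps)
  show "\<forall>\<^sub>F i in F. S i / (1 + z2 i) \<le> T i / z2 i"
    using low fugacity_pos by eventually_elim (simp add: field_simps)
  show "((\<lambda>i. S i / (1 + z2 i)) \<longlongrightarrow> L) F"
    using tendsto_divide[OF S tendsto_add[OF tendsto_const[of 1] fugacity_tendsto_0]] by simp
qed (rule S)

lemma tail_asymptotics:
  assumes c: "(c \<longlongrightarrow> c0) F" "\<And>i. c i \<ge> 0" "c0 \<ge> 0"
    and R: "\<forall>\<^sub>F i in F. \<forall>j. R i j \<longleftrightarrow> c i \<le> h i * real (Suc j)"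
  shows "((\<lambda>i. h i * (\<Sum>j. if R i j then boltzmann_params.occ (z1 i) (z2 i) (Suc j ^ q) else 0) / z2 i) \<longlongrightarrow> exp_tail q c0) F"
proof (rule occ_odds_sandwich)
  interpret e: tail_antiderivative "\<lambda>y. exp (- (y ^ q))" "exp_tail q"
    using q by (rule exp_tail_antiderivative)
  let ?S = "\<lambda>i. \<Sum>j. if c i \<le> h i * real (Suc j) then exp (- ((h i * real (Suc j)) ^ q)) else 0"
  show "((\<lambda>i. h i * ?S i) \<longlongrightarrow> exp_tail q c0) F"
    using c by (intro e.riemann_tail_tendsto scale_tendsto_0 scale_pos) auto
  let ?T = "\<lambda>i. \<Sum>j. if R i j then boltzmann_params.occ (z1 i) (z2 i) (Suc j ^ q) else 0"
  show "\<forall>\<^sub>F i in F. h i * ?T i \<le> z2 i * (h i * ?S i)"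
    using eventually_params scale_pos R
  proof eventually_elim
    case (elim i)
    then interpret boltzmann_params q "z1 i" "z2 i" by blast
    have "?T i \<le> z2 i * ?S i"
      using elim(3) c(2) by (intro mean_tail_bounds) auto
    then have "h i * ?T i \<le> h i * (z2 i * ?S i)"
      using elim(2) by (intro mult_left_mono) auto
    then show ?case by (simp only: mult.left_commute)
  qed
  show "\<forall>\<^sub>F i in F. z2 i * (h i * ?S i) / (1 + z2 i) \<le> h i * ?T i"
    using eventually_params scale_pos R
  proof eventually_elim
    case (elim i)
    then interpret boltzmann_params q "z1 i" "z2 i" by blast
    have "z2 i * ?S i / (1 + z2 i) \<le> ?T i"
      using elim(3) c(2) by (intro mean_tail_bounds) auto
    then have "h i * (z2 i * ?S i / (1 + z2 i)) \<le> h i * ?T i"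
      using elim(2) by (intro mult_left_mono) auto
    then show ?case by (simp only: mult.left_commute times_divide_eq_right)
  qed
qed

lemma M_asymptotics: "((\<lambda>i. h i * M i / z2 i) \<longlongrightarrow> E0) F"
proof -
  have "((\<lambda>i. h i * (\<Sum>j. if True then boltzmann_params.occ (z1 i) (z2 i) (Suc j ^ q) else 0) / z2 i) \<longlongrightarrow> E0) F"
    using scale_pos by (intro tail_asymptotics[where c = "\<lambda>_. 0"]) (auto elim!: eventually_mono)
  then show ?thesis
  proof (rule Lim_transform_eventually)
    show "\<forall>\<^sub>F i in F. h i * (\<Sum>j. if True then boltzmann_params.occ (z1 i) (z2 i) (Suc j ^ q) else 0) / z2 i = h i * M i / z2 i"
      using eventually_params
    proof eventually_elim
      case (elim i)
      then interpret boltzmann_params q "z1 i" "z2 i" by blast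
      show ?case using calibrated_means(2)[OF conjunct2[OF elim]] by simp
    qed
  qed
qed

lemma N_asymptotics: "((\<lambda>i. h i * (h i ^ q * N i) / z2 i) \<longlongrightarrow> E0 / real q) F"
proof (rule occ_odds_sandwich)
  interpret e: tail_antiderivative "\<lambda>y. exp (- (y ^ q))" "exp_tail q"
    using q by (rule exp_tail_antiderivative)
  interpret pe: tail_antiderivative "\<lambda>y. (1 + y ^ q) * exp (- (y ^ q))" "power_exp_tail q"
    using q by (rule power_exp_tail_antiderivative)
  let ?S = "\<lambda>i. \<Sum>j. (h i * real (Suc j)) ^ q * exp (- ((h i * real (Suc j)) ^ q))"
  let ?g = "\<lambda>i j. exp (- ((h i * real (Suc j)) ^ q))"
  let ?p = "\<lambda>i j. (1 + (h i * real (Suc j)) ^ q) * exp (- ((h i * real (Suc j)) ^ q))"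
  \<comment> \<open>The cutoff 0 admits every index and gives the sums the form of
    \<open>riemann_tail_tendsto\<close>.\<close>
  have 1: "((\<lambda>i. h i * (\<Sum>j. if 0 \<le> h i * real (Suc j) then ?g i j else 0)) \<longlongrightarrow> exp_tail q 0) F"
    by (intro e.riemann_tail_tendsto scale_tendsto_0 scale_pos) auto
  have 2: "((\<lambda>i. h i * (\<Sum>j. if 0 \<le> h i * real (Suc j) then ?p i j else 0)) \<longlongrightarrow> power_exp_tail q 0) F"
    by (intro pe.riemann_tail_tendsto scale_tendsto_0 scale_pos) auto
  have "((\<lambda>i. h i * (\<Sum>j. if 0 \<le> h i * real (Suc j) then ?p i j else 0)
      - h i * (\<Sum>j. if 0 \<le> h i * real (Suc j) then ?g i j else 0)) \<longlongrightarrow> E0 / real q) F"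
    using tendsto_diff[OF 2 1] by (simp add: power_exp_tail_0[OF q])
  then show "((\<lambda>i. h i * ?S i) \<longlongrightarrow> E0 / real q) F"
  proof (rule Lim_transform_eventually)
    show "\<forall>\<^sub>F i in F. h i * (\<Sum>j. if 0 \<le> h i * real (Suc j) then ?p i j else 0)
      - h i * (\<Sum>j. if 0 \<le> h i * real (Suc j) then ?g i j else 0) = h i * ?S i"
      using scale_pos
    proof eventually_elim
      case (elim i)
      have pos: "0 \<le> h i * real (Suc j)" for j using elim by simp
      have "suminf (?p i) - suminf (?g i) = (\<Sum>j. ?p i j - ?g i j)"
        using e.riemann_sum_from(1)[OF elim, of 0] pe.riemann_sum_from(1)[OF elim, of 0]
        by (intro suminf_diff) simp_all
      also have "\<dots> = ?S i" by (simp add: algebra_simps)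
      finally show ?case
        by (simp only: pos if_True flip: right_diff_distrib)
    qed
  qed
  show "\<forall>\<^sub>F i in F. h i * (h i ^ q * N i) \<le> z2 i * (h i * ?S i)"
    using eventually_params scale_pos
  proof eventually_elim
    case (elim i)
    then interpret boltzmann_params q "z1 i" "z2 i" by blast
    have "h i ^ q * N i \<le> z2 i * ?S i"
      using mean_weight_bounds(2) calibrated_means(1)[OF conjunct2[OF elim(1)]] by simp
    then have "h i * (h i ^ q * N i) \<le> h i * (z2 i * ?S i)"
      using elim(2) by (intro mult_left_mono) auto
    then show ?case by (simp only: mult.left_commute)
  qed
  show "\<forall>\<^sub>F i in F. z2 i * (h i * ?S i) / (1 + z2 i) \<le> h i * (h i ^ q * N i)"
    using eventually_params scale_pos
  proof eventually_elim
    case (elim i)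
    then interpret boltzmann_params q "z1 i" "z2 i" by blast
    have "z2 i * ?S i / (1 + z2 i) \<le> h i ^ q * N i"
      using mean_weight_bounds(3) calibrated_means(1)[OF conjunct2[OF elim(1)]] by simp
    then have "h i * (z2 i * ?S i / (1 + z2 i)) \<le> h i * (h i ^ q * N i)"
      using elim(2) by (intro mult_left_mono) auto
    then show ?case by (simp only: mult.left_commute times_divide_eq_right)
  qed
qed

text \<open>Dividing by the asymptotics of \<open>M\<close> cancels the common factor
  \<open>h / z2\<close>.\<close>

lemma ratio_asymptotics:
  assumes "((\<lambda>i. h i * T i / z2 i) \<longlongrightarrow> L) F"
  shows "((\<lambda>i. T i / M i) \<longlongrightarrow> L / E0) F"
proof -
  have "((\<lambda>i. (h i * T i / z2 i) / (h i * M i / z2 i)) \<longlongrightarrow> L / E0) F"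
    using exp_tail_0_pos[OF q] by (intro tendsto_divide assms M_asymptotics) auto
  then show ?thesis
  proof (rule Lim_transform_eventually)
    show "\<forall>\<^sub>F i in F. h i * T i / z2 i / (h i * M i / z2 i) = T i / M i"
      using scale_pos fugacity_pos by eventually_elim auto
  qed
qed

text \<open>A part lies beyond \<open>A * x\<close> exactly if its rescaled position lies beyond the
  \<open>q\<close>-th root of \<open>h ^ q * A * x\<close>. This root tends to
  \<open>root q x\<close>, because \<open>h ^ q * N / M\<close> tends to 1/q.\<close>

lemma mean_boundary_tendsto:
  assumes x: "x \<ge> 0"
  shows "((\<lambda>i. boltzmann_params.mean_tail q (z1 i) (z2 i) (real q * N i / M i * x) / M i) \<longlongrightarrow> limit_shape q x) F"
proof -
  let ?A = "\<lambda>i. real q * N i / M i * x"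
  \<comment> \<open>The \<open>max 0\<close> makes the cutoff nonnegative for every
    \<open>i\<close>, as \<open>tail_asymptotics\<close> asks, although \<open>N\<close> and
    \<open>M\<close> are positive only eventually.\<close>
  let ?c = "\<lambda>i. root q (max 0 (h i ^ q * ?A i))"
  have A: "((\<lambda>i. h i ^ q * ?A i) \<longlongrightarrow> x) F"
  proof -
    have "((\<lambda>i. real q * x * (h i ^ q * N i / M i)) \<longlongrightarrow> real q * x * (E0 / real q / E0)) F"
      by (intro tendsto_mult_left ratio_asymptotics N_asymptotics)
    then show ?thesis
      using exp_tail_0_pos[OF q] q by (simp add: mult_ac)
  qed
  have "((\<lambda>i. max 0 (h i ^ q * ?A i)) \<longlongrightarrow> max 0 x) F"
    by (intro tendsto_max tendsto_const A)
  then have c: "(?c \<longlongrightarrow> root q x) F"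
    using x by (auto dest: tendsto_real_root)
  have R: "\<forall>\<^sub>F i in F. \<forall>j. ?A i \<le> real (Suc j ^ q) \<longleftrightarrow> ?c i \<le> h i * real (Suc j)"
    using scale_pos eventually_M_ge[of 1] eventually_N_ge[of 1]
  proof eventually_elim
    case (elim i)
    have A0: "h i ^ q * ?A i \<ge> 0" using elim x by simp
    show ?case
    proof
      fix j
      have "?c i \<le> h i * real (Suc j) \<longleftrightarrow> root q (h i ^ q * ?A i) \<le> root q ((h i * real (Suc j)) ^ q)"
        using A0 elim q by (simp only: max.absorb2 real_root_power_cancel) (simp add: real_root_power_cancel)
      also have "\<dots> \<longleftrightarrow> h i ^ q * ?A i \<le> (h i * real (Suc j)) ^ q"
        using q by (simp only: real_root_le_iff)
      also have "\<dots> \<longleftrightarrow> h i ^ q * ?A i \<le> h i ^ q * real (Suc j ^ q)"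
        by (simp add: power_mult_distrib)
      also have "\<dots> \<longleftrightarrow> ?A i \<le> real (Suc j ^ q)"
        using elim by (intro mult_le_cancel_left_pos) simp
      finally show "?A i \<le> real (Suc j ^ q) \<longleftrightarrow> ?c i \<le> h i * real (Suc j)" ..
    qed
  qed
  have "((\<lambda>i. (\<Sum>j. if ?A i \<le> real (Suc j ^ q) then boltzmann_params.occ (z1 i) (z2 i) (Suc j ^ q) else 0) / M i)
      \<longlongrightarrow> exp_tail q (root q x) / E0) F"
    using x by (intro ratio_asymptotics tail_asymptotics[OF c _ _ R] real_root_ge_zero) auto
  moreover have "exp_tail q (root q x) / E0 = limit_shape q x"
    using exp_tail_root[OF q x] exp_tail_0_pos[OF q] by simp
  ultimately have "((\<lambda>i. (\<Sum>j. if ?A i \<le> real (Suc j ^ q) then boltzmann_params.occ (z1 i) (z2 i) (Suc j ^ q) else 0) / M i)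
      \<longlongrightarrow> limit_shape q x) F" by simp
  then show ?thesis
  proof (rule Lim_transform_eventually)
    show "\<forall>\<^sub>F i in F. (\<Sum>j. if ?A i \<le> real (Suc j ^ q) then boltzmann_params.occ (z1 i) (z2 i) (Suc j ^ q) else 0) / M i =
        boltzmann_params.mean_tail q (z1 i) (z2 i) (?A i) / M i"
      using eventually_params
      by eventually_elim (auto simp: boltzmann_params.mean_tail_def)
  qed
qed

text \<open>Half of \<open>\<eta>\<close> is spent on the distance of the mean from the limit. The
  other half goes into Chebyshev's inequality, whose bound \<open>M / (\<eta> / 2 * M) ^ 2\<close>
  is of order \<open>1 / M\<close>.\<close>

lemma boundary_pointwise:
  assumes x: "x \<ge> 0" and \<eta>: "\<eta> > 0"
  shows "((\<lambda>i. measure (boltzmann q (z1 i) (z2 i))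
      {p \<in> strict_partitions q. \<eta> \<le> \<bar>scaled_boundary q (N i) (M i) p x - limit_shape q x\<bar>}) \<longlongrightarrow> 0) F"
proof (rule tendsto_sandwich[of "\<lambda>_. 0"])
  let ?m = "\<lambda>i. boltzmann_params.mean_tail q (z1 i) (z2 i) (real q * N i / M i * x)"
  have "\<forall>\<^sub>F i in F. dist (?m i / M i) (limit_shape q x) < \<eta> / 2"
    using \<eta> by (intro tendstoD[OF mean_boundary_tendsto[OF x]]) auto
  then show "\<forall>\<^sub>F i in F. measure (boltzmann q (z1 i) (z2 i))
      {p \<in> strict_partitions q. \<eta> \<le> \<bar>scaled_boundary q (N i) (M i) p x - limit_shape q x\<bar>} \<le> 4 / \<eta>\<^sup>2 / M i"
    using eventually_params eventually_M_ge[of 1]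
  proof eventually_elim
    case (elim i)
    then interpret boltzmann_params q "z1 i" "z2 i" by blast
    let ?Y = "\<lambda>p. young_boundary p (real q * N i / M i * x)"
    have sub: "\<eta> / 2 * M i \<le> \<bar>?Y p - ?m i\<bar>"
      if "\<eta> \<le> \<bar>scaled_boundary q (N i) (M i) p x - limit_shape q x\<bar>" for p
    proof -
      have "\<eta> \<le> \<bar>?Y p / M i - limit_shape q x\<bar>"
        using that by (simp add: scaled_boundary_def)
      then have "\<eta> / 2 \<le> \<bar>?Y p / M i - ?m i / M i\<bar>"
        using elim(1) unfolding dist_real_def by linarith
      also have "\<dots> = \<bar>?Y p - ?m i\<bar> / M i"
        using elim(3) by (simp flip: diff_divide_distrib)
      finally show ?thesis using elim(3) by (simp add: field_simps)
    qed
    have "prob {p \<in> SP. \<eta> \<le> \<bar>scaled_boundary q (N i) (M i) p x - limit_shape q x\<bar>}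
        \<le> prob {p \<in> SP. \<eta> / 2 * M i \<le> \<bar>?Y p - ?m i\<bar>}"
      using sub by (intro finite_measure_mono) auto
    also have "\<dots> \<le> mean_len / (\<eta> / 2 * M i)\<^sup>2"
      using elim \<eta> by (intro young_boundary_deviation) auto
    also have "mean_len = M i"
      using calibrated_means(2)[OF conjunct2[OF elim(2)]] by simp
    also have "M i / (\<eta> / 2 * M i)\<^sup>2 = 4 / \<eta>\<^sup>2 / M i"
      using elim(3) \<eta> by (simp add: power2_eq_square field_simps)
    finally show ?case .
  qed
  show "((\<lambda>i. 4 / \<eta>\<^sup>2 / M i) \<longlongrightarrow> 0) F"
    by (rule real_tendsto_divide_at_top[OF tendsto_const M])
qed auto

text \<open>The grid depends only on the limit shape and \<open>\<epsilon>\<close>, so a union bound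
  over finitely many points, the same for all \<open>i\<close>, reduces the claim to single
  abscissas.\<close>

lemma boundary_uniform:
  assumes \<epsilon>: "\<epsilon> > 0"
  shows "((\<lambda>i. measure (boltzmann q (z1 i) (z2 i))
      {p \<in> strict_partitions q.
        (SUP x\<in>{0..}. \<bar>scaled_boundary q (N i) (M i) p x - limit_shape q x\<bar>) > \<epsilon>}) \<longlongrightarrow> 0) F"
proof -
  obtain C where C: "finite C" "C \<subseteq> {0..}" and grid:
    "\<And>f. (\<And>x y. 0 \<le> x \<Longrightarrow> x \<le> y \<Longrightarrow> f y \<le> f x) \<Longrightarrow> (\<And>x. f x \<ge> 0) \<Longrightarrow>
      (\<And>c. c \<in> C \<Longrightarrow> \<bar>f c - limit_shape q c\<bar> < \<epsilon> / 2) \<Longrightarrow> \<forall>x\<ge>0. \<bar>f x - limit_shape q x\<bar> \<le> \<epsilon>"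
    using uniform_grid[OF limit_shape_continuous[OF q] limit_shape_antimono[OF q] limit_shape_0[OF q]
        limit_shape_tendsto_0[OF q] limit_shape_nonneg[OF q] \<epsilon>] by metis
  let ?B = "\<lambda>i c. {p \<in> strict_partitions q. \<epsilon> / 2 \<le> \<bar>scaled_boundary q (N i) (M i) p c - limit_shape q c\<bar>}"
  show ?thesis
  proof (rule tendsto_sandwich[of "\<lambda>_. 0"])
    show "\<forall>\<^sub>F i in F. measure (boltzmann q (z1 i) (z2 i))
      {p \<in> strict_partitions q.
        (SUP x\<in>{0..}. \<bar>scaled_boundary q (N i) (M i) p x - limit_shape q x\<bar>) > \<epsilon>}
      \<le> (\<Sum>c\<in>C. measure (boltzmann q (z1 i) (z2 i)) (?B i c))"
      using eventually_params eventually_M_ge[of 1] eventually_N_ge[of 1]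
    proof eventually_elim
      case (elim i)
      then interpret boltzmann_params q "z1 i" "z2 i" by blast
      have "(SUP x\<in>{0..}. \<bar>scaled_boundary q (N i) (M i) p x - limit_shape q x\<bar>) \<le> \<epsilon>"
        if "p \<in> SP" "p \<notin> (\<Union>c\<in>C. ?B i c)" for p
      \<comment> \<open>A pointwise bound and a nonempty index set suffice here, so boundedness of
        the family is no separate obligation.\<close>
      proof (rule cSUP_least)
        fix x :: real assume "x \<in> {0..}"
        then show "\<bar>scaled_boundary q (N i) (M i) p x - limit_shape q x\<bar> \<le> \<epsilon>"
          using that elim
          by (intro grid[of "scaled_boundary q (N i) (M i) p", rule_format])
             (auto intro: scaled_boundary_antimono scaled_boundary_nonneg)
      qed auto
      then have "{p \<in> SP. (SUP x\<in>{0..}. \<bar>scaled_boundary q (N i) (M i) p x - limit_shape q x\<bar>) > \<epsilon>}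
          \<subseteq> (\<Union>c\<in>C. ?B i c)"
        by force
      then have "prob {p \<in> SP. (SUP x\<in>{0..}. \<bar>scaled_boundary q (N i) (M i) p x - limit_shape q x\<bar>) > \<epsilon>}
          \<le> prob (\<Union>c\<in>C. ?B i c)"
        by (intro finite_measure_mono) auto
      also have "\<dots> \<le> (\<Sum>c\<in>C. prob (?B i c))"
        using C by (intro finite_measure_subadditive_finite) auto
      finally show ?case .
    qed
    show "((\<lambda>i. \<Sum>c\<in>C. measure (boltzmann q (z1 i) (z2 i)) (?B i c)) \<longlongrightarrow> 0) F"
      using C \<epsilon> by (intro tendsto_null_sum boundary_pointwise) auto
  qed auto
qed

end

theorem theorem5p5:
  fixes q :: nat
    and N M z1 z2 :: "'i \<Rightarrow> real"
    and F :: "'i filter"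
    and \<epsilon> :: real
  assumes "q \<ge> 1"
    and "filterlim N at_top F"
    and "filterlim M at_top F"
    and "((\<lambda>i. M i ^ (q + 1) / N i) \<longlongrightarrow> 0) F"
    and "\<forall>\<^sub>F i in F. calibrated q (N i) (M i) (z1 i) (z2 i)"
    and "\<epsilon> > 0"
  shows "((\<lambda>i. measure (boltzmann q (z1 i) (z2 i))
            {p \<in> strict_partitions q.
               (SUP x\<in>{0..}. \<bar>scaled_boundary q (N i) (M i) p x - limit_shape q x\<bar>) > \<epsilon>})
          \<longlongrightarrow> 0) F"
proof -
  interpret calibrated_regime q N M z1 z2 F
    using assms by unfold_locales
  show ?thesis
    using assms(6) by (rule boundary_uniform)
qed

end
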